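(* Let $m,k$ be integers and let $\mathbf u=(u_0,\dots,u_{k-1})$, $\mathbf v=(v_0,\dots,v_{k-1})$ with $u_i=(2i,-2i)$ and $v_i=(2i+3,m-k-i-1)$ for $0\le i\le k-1$. (i) If $m\ge0$ and $0\le k\le m$, then $P_{m,k}(q)$ equals the sum, over all families $(L_0,\dots,L_{k-1})$ of pairwise non-intersecting lattice paths with $L_i$ going from $u_i$ to $v_i$, of the product of the weights of all steps, where a vertical step with even $x$-coordinate has weight $q$ and all other steps have weight $1$. (ii) If $m\ge1$ and $0\le k\le m-1$, then $Q_{m,k}(q)$ equals the same sum, where now a vertical step starting at one of the points $u_j$ has weight $q^2+q$, any other vertical step with even $x$-coordinate has weight $q^2$, and all other steps have weight $1$.
   Context: A lattice path is a sequence of points of $\mathbb{Z}^2$ in which each step is $(1,0)$ (horizontal) or $(0,1)$ (vertical); the $x$-coordinate of a vertical step is the common $x$-coordinate of its endpoints. Paths are non-intersecting if they share no lattice point. The empty family ($k=0$) has weight $1$. $[k]=\frac{1-q^k}{1-q}$, $[k]!=\prod_{i=1}^k[i]$, $[0]!=1$. Let $S_{m,n}(q)=\sum_{k=1}^n\frac{[2k]}{[2]}[k]^{m-1}q^{\frac{m+1}{2}(n-k)}$. The polynomials $P_{m,j},Q_{m,j}\in\mathbb{Z}[q]$ are those (shown to exist by Guo and Zeng, and uniquely determined) such that for all $n\ge1$: $S_{2m+1,n}(q)=\sum_{k=0}^m(-q^n)^{m-k}\frac{[k]!}{[m+1]!}P_{m,m-k}(q)\frac{([n][n+1])^{k+1}}{[2]}$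 for $m\ge0$, and $S_{2m,n}(q)=(1-q^{n+\frac12})\sum_{k=0}^m(-q^n)^{m-k}\frac{(1-q^{\frac12})^{m-k}Q_{m,m-k}(q^{\frac12})}{\prod_{i=0}^{m-k}(1-q^{m-i+\frac12})}\frac{([n][n+1])^k}{[2]}$ for $m\ge1$. *)

theory Defs
  imports Complex_Main "HOL-Computational_Algebra.Polynomial"
begin

definition qint :: "real \<Rightarrow> nat \<Rightarrow> real" where
  "qint q k = (1 - q ^ k) / (1 - q)"

definition qfact :: "real \<Rightarrow> nat \<Rightarrow> real" where
  "qfact q k = (\<Prod>i = 1..k. qint q i)"

text \<open>S_{m,n}(q) = sum_{k=1}^n [2k]/[2] [k]^(m-1) q^((m+1)/2 (n-k)), with
  q^((m+1)/2 (n-k)) written as (sqrt q)^((m+1)(n-k)).  Used only for m >= 1.\<close>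
definition S_sum :: "real \<Rightarrow> nat \<Rightarrow> nat \<Rightarrow> real" where
  "S_sum q m n = (\<Sum>k = 1..n. qint q (2 * k) / qint q 2 * qint q k ^ (m - 1)
                      * sqrt q ^ ((m + 1) * (n - k)))"

definition GZ_P_prop :: "nat \<Rightarrow> (nat \<Rightarrow> int poly) \<Rightarrow> bool" where
  "GZ_P_prop m P \<longleftrightarrow> (\<forall>j > m. P j = 0) \<and>
     (\<forall>n \<ge> 1. \<forall>q::real. 0 < q \<and> q < 1 \<longrightarrow>
        S_sum q (2 * m + 1) n =
          (\<Sum>k = 0..m. (- (q ^ n)) ^ (m - k) * (qfact q k / qfact q (m + 1))
              * poly (map_poly of_int (P (m - k))) q
              * (qint q n * qint q (n + 1)) ^ (k + 1) / qint q 2))"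

definition GZ_P :: "nat \<Rightarrow> nat \<Rightarrow> int poly" where
  "GZ_P m = (THE P. GZ_P_prop m P)"

definition GZ_Q_prop :: "nat \<Rightarrow> (nat \<Rightarrow> int poly) \<Rightarrow> bool" where
  "GZ_Q_prop m Q \<longleftrightarrow> (\<forall>j > m. Q j = 0) \<and>
     (\<forall>n \<ge> 1. \<forall>q::real. 0 < q \<and> q < 1 \<longrightarrow>
        S_sum q (2 * m) n =
          (1 - q ^ n * sqrt q) *
          (\<Sum>k = 0..m. (- (q ^ n)) ^ (m - k)
              * ((1 - sqrt q) ^ (m - k) * poly (map_poly of_int (Q (m - k))) (sqrt q)
                 / (\<Prod>i = 0..m - k. 1 - q ^ (m - i) * sqrt q))
              * (qint q n * qint q (n + 1)) ^ k / qint q 2))"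

definition GZ_Q :: "nat \<Rightarrow> nat \<Rightarrow> int poly" where
  "GZ_Q m = (THE Q. GZ_Q_prop m Q)"

definition lattice_path :: "(int \<times> int) list \<Rightarrow> int \<times> int \<Rightarrow> int \<times> int \<Rightarrow> bool" where
  "lattice_path L a b \<longleftrightarrow> L \<noteq> [] \<and> hd L = a \<and> last L = b \<and>
     (\<forall>i. Suc i < length L \<longrightarrow>
        (fst (L ! Suc i) = fst (L ! i) + 1 \<and> snd (L ! Suc i) = snd (L ! i)) \<or>
        (fst (L ! Suc i) = fst (L ! i) \<and> snd (L ! Suc i) = snd (L ! i) + 1))"

definition path_weight :: "((int \<times> int) \<Rightarrow> (int \<times> int) \<Rightarrow> int poly) \<Rightarrow> (int \<times> int) list \<Rightarrow> int poly" where
  "path_weight w L = prod_list (map (\<lambda>i. w (L ! i) (L ! Suc i)) [0..<length L - 1])"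

definition pt_u :: "nat \<Rightarrow> int \<times> int" where
  "pt_u i = (2 * int i, - 2 * int i)"

definition pt_v :: "nat \<Rightarrow> nat \<Rightarrow> nat \<Rightarrow> int \<times> int" where
  "pt_v m k i = (2 * int i + 3, int m - int k - int i - 1)"

definition path_families :: "nat \<Rightarrow> nat \<Rightarrow> (nat \<Rightarrow> (int \<times> int) list) set" where
  "path_families m k = {L. (\<forall>i < k. lattice_path (L i) (pt_u i) (pt_v m k i)) \<and>
       (\<forall>i \<ge> k. L i = []) \<and>
       (\<forall>i < k. \<forall>j < k. i \<noteq> j \<longrightarrow> set (L i) \<inter> set (L j) = {})}"

definition path_sum :: "((int \<times> int) \<Rightarrow> (int \<times> int) \<Rightarrow> int poly) \<Rightarrow> nat \<Rightarrow> nat \<Rightarrow> int poly" where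
  "path_sum w m k = (\<Sum>L \<in> path_families m k. \<Prod>i < k. path_weight w (L i))"

definition weight_P :: "(int \<times> int) \<Rightarrow> (int \<times> int) \<Rightarrow> int poly" where
  "weight_P a b = (if fst a = fst b \<and> even (fst a) then [:0, 1:] else 1)"

definition weight_Q :: "nat \<Rightarrow> (int \<times> int) \<Rightarrow> (int \<times> int) \<Rightarrow> int poly" where
  "weight_Q k a b = (if fst a = fst b then
        (if a \<in> pt_u ` {..<k} then [:0, 1, 1:]
         else if even (fst a) then [:0, 0, 1:] else 1)
      else 1)"

end

theory Submission
  imports Defs
begin

text \<open>
  A path \<open>L_i\<close> makes exactly three horizontal steps, so it is a triple of heights
  \<open>x \<le> y \<le> z\<close>, measured from its starting point, and the only possible intersections are between
  consecutive paths, where disjointness means \<open>x' \<le> y + 1\<close> and \<open>y' \<le> z + 1\<close>.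
  Expanding the factor "does not intersect" as "all minus intersecting", from the first path on, and
  swapping the tails of intersecting neighbours turns the path sum into a triangular recurrence whose
  coefficients are generating functions of single paths.

  On the other side, comparing \<open>S_{m,n}\<close> with \<open>S_{m,n-1}\<close> and
  dividing by \<open>1 + q^n\<close> leaves the complete homogeneous polynomials (for \<open>Q\<close>, a variant of them)
  in \<open>a = [n+1]\<close> and \<open>b = q[n-1]\<close>. As \<open>a + b = (1+q)[n]\<close> and \<open>ab = q[n]^2 - q^n\<close>, these
  expand in powers of \<open>q^n\<close> with the same single-path generating functions as coefficients, so the
  coefficients of the Faulhaber-type formula satisfy the same recurrence. The case \<open>P\<close> is
  \<open>\<kappa> = q\<close>; in the case \<open>Q\<close> the roles of \<open>q\<close> and \<open>\<kappa>\<close> are played by \<open>q^2\<close> and \<open>q^2 + q\<close>.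
\<close>

section \<open>Sums over chains of height triples\<close>

context
  fixes q \<kappa> :: "'a::comm_ring_1"
begin

text \<open>Weight of the first column of a path with \<open>r\<close> vertical steps there; the step leaving the
  starting point has weight \<open>\<kappa>\<close>.\<close>

definition column_weight :: "nat \<Rightarrow> 'a" where
  "column_weight r = (if r = 0 then 1 else \<kappa> * q ^ (r - 1))"

text \<open>The paths counted here have their final height below \<open>M\<close>, \<open>M + 1\<close>, and so on; the bounds \<open>b\<close> and \<open>c\<close>
  express disjointness from the preceding path. The shift by 1 comes from \<open>u_{i+1}\<close> lying two units
  below \<open>u_i\<close>.\<close>

primrec chain_sum :: "nat \<Rightarrow> nat \<Rightarrow> nat \<Rightarrow> nat \<Rightarrow> 'a" where
  "chain_sum 0 M b c = 1"
| "chain_sum (Suc n) M b c = (\<Sum>z<M. \<Sum>y\<le>z. \<Sum>x\<le>y. if x \<le> b \<and> y \<le> c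
     then column_weight x * q ^ (z - y) * chain_sum n (Suc M) (Suc y) (Suc z) else 0)"

text \<open>Here the first column of the first path is replaced by an arbitrary weight
  \<open>f\<close> of the height \<open>y\<close>. Each tail swap makes the leading path longer, so
  \<open>f\<close> has to range over all \<open>single_path_sum j\<close>.\<close>

definition weighted_chain_sum :: "nat \<Rightarrow> nat \<Rightarrow> (nat \<Rightarrow> 'a) \<Rightarrow> 'a" where
  "weighted_chain_sum n M f =
     (\<Sum>z<M. \<Sum>y\<le>z. f y * q ^ (z - y) * chain_sum n (Suc M) (Suc y) (Suc z))"

text \<open>Sum over the paths from \<open>u_0\<close> that enter column \<open>2j + 1\<close> and end there at height \<open>r - 2j\<close>; measuring
  heights from \<open>u_j\<close> makes \<open>r\<close> a natural number.\<close>

primrec single_path_sum :: "nat \<Rightarrow> nat \<Rightarrow> 'a" where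
  "single_path_sum 0 r = (\<Sum>x\<le>r. column_weight x)"
| "single_path_sum (Suc j) r = (\<Sum>z<r - 1. \<Sum>y\<le>z. single_path_sum j y * q ^ (z - y))"

text \<open>Bounds equal to \<open>M\<close> never bind, because
  \<open>x \<le> y \<le> z < M\<close> already; the sum over \<open>x\<close> is then
  \<open>single_path_sum 0 y\<close>.\<close>

lemma chain_sum_Suc_free:
  "chain_sum (Suc n) M M M = weighted_chain_sum n M (single_path_sum 0)"
proof -
  have "(\<Sum>x\<le>y. if x \<le> M \<and> y \<le> M
     then column_weight x * q ^ (z - y) * chain_sum n (Suc M) (Suc y) (Suc z) else 0)
     = single_path_sum 0 y * q ^ (z - y) * chain_sum n (Suc M) (Suc y) (Suc z)"
    if "z < M" "y \<le> z" for y z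
    using that by (auto simp: sum_distrib_right intro!: sum.cong)
  then show ?thesis
    by (simp add: weighted_chain_sum_def)
qed

lemma triangle_sum_swap:
  "(\<Sum>z<M::nat. \<Sum>y\<le>z. f y z) = (\<Sum>y<M. \<Sum>z\<in>{y..<M}. (f y z :: 'a))"
  by (subst (1 2) sum.Sigma; force intro!: sum.reindex_bij_witness[of _ prod.swap prod.swap])

lemma column_weight_Suc_Suc: "column_weight (Suc (Suc (y + d))) = \<kappa> * q ^ Suc y * q ^ d"
  by (simp add: column_weight_def power_add algebra_simps)

text \<open>This is the tail swap of the Lindstroem-Gessel-Viennot argument: \<open>y\<close> and \<open>z\<close> belong to one path,
  \<open>x\<close> and \<open>y'\<close> to the next one, and exchanging \<open>z + 2\<close> with \<open>x\<close> preserves the weight because \<open>x\<close>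
  is positive.\<close>

lemma intersecting_pair_sum:
  assumes "y < M" "y' \<le> M"
  shows "(\<Sum>z\<in>{y..<M}. q ^ (z - y) *
            (\<Sum>x\<le>y'. if x \<le> Suc y \<and> y' \<le> Suc z then 0 else column_weight x))
       = single_path_sum 0 (Suc M) * (\<Sum>z\<in>{y..<y' - 1}. q ^ (z - y))"
proof (cases "y' \<le> Suc y")
  \<comment> \<open>Here \<open>x \<le> y' \<le> Suc y \<le> Suc z\<close>, so no pair intersects
    and both sides vanish.\<close>
  case True
  then show ?thesis by (auto intro!: sum.neutral)
next
  case False
  define S1 where "S1 = (\<Sum>z\<in>{y..<y' - 1}. q ^ (z - y))"
  define S2 where "S2 = (\<Sum>z\<in>{y' - 1..<M}. q ^ (z - y))"
  define A where "A = (\<Sum>x\<le>y'. column_weight x)"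
  have shift: "(\<Sum>x\<in>{Suc (Suc a)..<Suc (Suc b)}. column_weight x)
      = \<kappa> * q ^ Suc y * (\<Sum>z\<in>{a..<b}. q ^ (z - y))" if "y \<le> a" for a b
  proof -
    have "(\<Sum>x\<in>{Suc (Suc a)..<Suc (Suc b)}. column_weight x)
        = (\<Sum>z\<in>{a..<b}. column_weight (Suc (Suc z)))"
      by (simp only: sum.shift_bounds_Suc_ivl)
    also have "\<dots> = (\<Sum>z\<in>{a..<b}. \<kappa> * q ^ Suc y * q ^ (z - y))"
    proof (rule sum.cong)
      fix z assume "z \<in> {a..<b}"
      then show "column_weight (Suc (Suc z)) = \<kappa> * q ^ Suc y * q ^ (z - y)"
        using column_weight_Suc_Suc[of y "z - y"] that by simp
    qed simp
    finally show ?thesis by (simp add: sum_distrib_left)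
  qed
  have B: "(\<Sum>x\<in>{Suc (Suc y)..y'}. column_weight x) = \<kappa> * q ^ Suc y * S1"
    using shift[of y "y' - 1"] False by (simp add: S1_def flip: atLeastLessThanSuc_atLeastAtMost)
  have C: "(\<Sum>x\<in>{Suc y'..Suc M}. column_weight x) = \<kappa> * q ^ Suc y * S2"
    using shift[of "y' - 1" M] False by (simp add: S2_def flip: atLeastLessThanSuc_atLeastAtMost)
  \<comment> \<open>For \<open>z < y' - 1\<close> every \<open>x\<close> gives an intersection; for
    larger \<open>z\<close> exactly the \<open>x\<close> above \<open>Suc y\<close> do.\<close>
  have split: "{y..<M} = {y..<y' - 1} \<union> {y' - 1..<M}" using False assms by auto
  have "(\<Sum>z\<in>{y..<M}. q ^ (z - y) *
            (\<Sum>x\<le>y'. if x \<le> Suc y \<and> y' \<le> Suc z then 0 else column_weight x))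
      = (\<Sum>z\<in>{y..<y' - 1}. q ^ (z - y) * A) +
        (\<Sum>z\<in>{y' - 1..<M}. q ^ (z - y) * (\<Sum>x\<in>{Suc (Suc y)..y'}. column_weight x))"
  proof (subst split, subst sum.union_disjoint)
    have "(\<Sum>x\<le>y'. if x \<le> Suc y \<and> y' \<le> Suc z then 0 else column_weight x)
        = (\<Sum>x\<in>{Suc (Suc y)..y'}. column_weight x)" if "z \<in> {y' - 1..<M}" for z
      by (rule sum.mono_neutral_cong_right) (use that in auto)
    moreover have "(\<Sum>x\<le>y'. if x \<le> Suc y \<and> y' \<le> Suc z then 0 else column_weight x) = A"
      if "z \<in> {y..<y' - 1}" for z
      unfolding A_def by (rule sum.cong) (use that in auto)
    ultimately show
      "(\<Sum>z\<in>{y..<y' - 1}. q ^ (z - y) *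
            (\<Sum>x\<le>y'. if x \<le> Suc y \<and> y' \<le> Suc z then 0 else column_weight x)) +
       (\<Sum>z\<in>{y' - 1..<M}. q ^ (z - y) *
            (\<Sum>x\<le>y'. if x \<le> Suc y \<and> y' \<le> Suc z then 0 else column_weight x))
      = (\<Sum>z\<in>{y..<y' - 1}. q ^ (z - y) * A) +
        (\<Sum>z\<in>{y' - 1..<M}. q ^ (z - y) * (\<Sum>x\<in>{Suc (Suc y)..y'}. column_weight x))"
      by simp
  qed auto
  also have "\<dots> = S1 * A + S2 * (\<kappa> * q ^ Suc y * S1)"
    by (simp add: S1_def S2_def B flip: sum_distrib_right)
  also have "\<dots> = (A + \<kappa> * q ^ Suc y * S2) * S1" by (simp add: algebra_simps)
  \<comment> \<open>The values \<open>z + 2\<close> for \<open>z\<close> from \<open>y' - 1\<close>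
    to \<open>M - 1\<close> continue the column from \<open>y'\<close> up to \<open>M + 1\<close>,
    so the swapped column is unrestricted.\<close>
  also have "A + \<kappa> * q ^ Suc y * S2 = single_path_sum 0 (Suc M)"
  proof -
    have "{..Suc M} = {..y'} \<union> {Suc y'..Suc M}" using assms by auto
    moreover have "{..y'} \<inter> {Suc y'..Suc M} = {}" by auto
    ultimately show ?thesis by (simp only: A_def single_path_sum.simps sum.union_disjoint
        finite_atMost finite_atLeastAtMost flip: C)
  qed
  finally show ?thesis by (simp add: S1_def)
qed

text \<open>All pairs minus the intersecting ones. After the swap the intersecting part factors into
  a free first column and the leading path prolonged by two columns, which is how
  \<open>single_path_sum (Suc j)\<close> arises from \<open>single_path_sum j\<close>.\<close>

lemma adjacent_pair_sum:
  assumes "y' \<le> M"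
  shows "(\<Sum>z<M. \<Sum>y\<le>z. f y * q ^ (z - y) *
            (\<Sum>x\<le>y'. if x \<le> Suc y \<and> y' \<le> Suc z then column_weight x else 0))
       = (\<Sum>z<M. \<Sum>y\<le>z. f y * q ^ (z - y)) * single_path_sum 0 y'
         - single_path_sum 0 (Suc M) * (\<Sum>z<y' - 1. \<Sum>y\<le>z. f y * q ^ (z - y))"
proof -
  have compl: "(\<Sum>x\<le>y'. if x \<le> Suc y \<and> y' \<le> Suc z then column_weight x else 0)
      = single_path_sum 0 y' - (\<Sum>x\<le>y'. if x \<le> Suc y \<and> y' \<le> Suc z then 0 else column_weight x)"
    for y z
    by (simp flip: sum_subtractf) (auto intro!: sum.cong)
  have "(\<Sum>z<M. \<Sum>y\<le>z. f y * q ^ (z - y) *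
            (\<Sum>x\<le>y'. if x \<le> Suc y \<and> y' \<le> Suc z then 0 else column_weight x))
      = (\<Sum>y<M. f y * (\<Sum>z\<in>{y..<M}. q ^ (z - y) *
            (\<Sum>x\<le>y'. if x \<le> Suc y \<and> y' \<le> Suc z then 0 else column_weight x)))"
    by (subst triangle_sum_swap) (simp add: sum_distrib_left mult.assoc)
  also have "\<dots> = (\<Sum>y<M. f y * (single_path_sum 0 (Suc M) * (\<Sum>z\<in>{y..<y' - 1}. q ^ (z - y))))"
    by (rule sum.cong) (use intersecting_pair_sum assms in auto)
  also have "\<dots> = single_path_sum 0 (Suc M) * (\<Sum>y<M. \<Sum>z\<in>{y..<y' - 1}. f y * q ^ (z - y))"
    by (simp add: sum_distrib_left mult_ac)
  also have "(\<Sum>y<M. \<Sum>z\<in>{y..<y' - 1}. f y * q ^ (z - y))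
      = (\<Sum>y<y' - 1. \<Sum>z\<in>{y..<y' - 1}. f y * q ^ (z - y))"
    by (rule sum.mono_neutral_right) (use assms in auto)
  also have "\<dots> = (\<Sum>z<y' - 1. \<Sum>y\<le>z. f y * q ^ (z - y))"
    by (rule triangle_sum_swap[symmetric])
  finally show ?thesis
    unfolding compl right_diff_distrib sum_subtractf by (simp only: sum_distrib_right)
qed

lemma weighted_chain_sum_Suc:
  "weighted_chain_sum (Suc n) M f =
     (\<Sum>z<M. \<Sum>y\<le>z. f y * q ^ (z - y)) * chain_sum (Suc n) (Suc M) (Suc M) (Suc M)
     - single_path_sum 0 (Suc M)
       * weighted_chain_sum n (Suc M) (\<lambda>y'. \<Sum>z<y' - 1. \<Sum>y\<le>z. f y * q ^ (z - y))"
proof -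
  define C g where "C = (\<Sum>z<M. \<Sum>y\<le>z. f y * q ^ (z - y))"
    and "g y' = (\<Sum>z<y' - 1. \<Sum>y\<le>z. f y * q ^ (z - y))" for y'
  \<comment> \<open>The remaining chain sees the second path only through \<open>y'\<close> and
    \<open>z'\<close>. Hence \<open>E\<close> can be moved out of the sums over the first path and
    over \<open>x\<close>, which leaves the pair sum already evaluated.\<close>
  define E where "E y z = q ^ (z - y) * chain_sum n (Suc (Suc M)) (Suc y) (Suc z)" for y z
  have "weighted_chain_sum (Suc n) M f = (\<Sum>z<M. \<Sum>y\<le>z. \<Sum>z'<Suc M. \<Sum>y'\<le>z'. f y * q ^ (z - y) *
     (\<Sum>x\<le>y'. if x \<le> Suc y \<and> y' \<le> Suc z then column_weight x else 0) * E y' z')"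
    unfolding weighted_chain_sum_def chain_sum.simps E_def sum_distrib_left sum_distrib_right
    by (intro sum.cong) (auto simp: mult_ac)
  also have "\<dots> = (\<Sum>z<M. \<Sum>z'<Suc M. \<Sum>y\<le>z. \<Sum>y'\<le>z'. f y * q ^ (z - y) *
     (\<Sum>x\<le>y'. if x \<le> Suc y \<and> y' \<le> Suc z then column_weight x else 0) * E y' z')"
    by (intro sum.cong refl sum.swap)
  also have "\<dots> = (\<Sum>z'<Suc M. \<Sum>z<M. \<Sum>y\<le>z. \<Sum>y'\<le>z'. f y * q ^ (z - y) *
     (\<Sum>x\<le>y'. if x \<le> Suc y \<and> y' \<le> Suc z then column_weight x else 0) * E y' z')"
    by (rule sum.swap)
  also have "\<dots> = (\<Sum>z'<Suc M. \<Sum>z<M. \<Sum>y'\<le>z'. \<Sum>y\<le>z. f y * q ^ (z - y) *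
     (\<Sum>x\<le>y'. if x \<le> Suc y \<and> y' \<le> Suc z then column_weight x else 0) * E y' z')"
    by (intro sum.cong refl sum.swap)
  also have "\<dots> = (\<Sum>z'<Suc M. \<Sum>y'\<le>z'. \<Sum>z<M. \<Sum>y\<le>z. f y * q ^ (z - y) *
     (\<Sum>x\<le>y'. if x \<le> Suc y \<and> y' \<le> Suc z then column_weight x else 0) * E y' z')"
    by (intro sum.cong refl sum.swap)
  also have "\<dots> = (\<Sum>z'<Suc M. \<Sum>y'\<le>z'.
      (C * single_path_sum 0 y' - single_path_sum 0 (Suc M) * g y') * E y' z')"
    unfolding C_def g_def
    by (intro sum.cong refl, subst adjacent_pair_sum[symmetric])
       (auto simp: sum_distrib_right simp del: single_path_sum.simps)
  also have "\<dots> = C * chain_sum (Suc n) (Suc M) (Suc M) (Suc M)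
     - single_path_sum 0 (Suc M) * weighted_chain_sum n (Suc M) g"
    unfolding chain_sum_Suc_free weighted_chain_sum_def sum_distrib_left[of _ _ "{..<Suc M}"]
      left_diff_distrib sum_subtractf E_def
    by (simp only: sum_distrib_left mult.assoc)
  finally show ?thesis unfolding C_def g_def[abs_def] .
qed

text \<open>Iterating the previous identity: every swap costs a sign and one free column, raises
  \<open>j\<close> and \<open>M\<close> by one and removes one path from the chain.\<close>

lemma weighted_chain_sum_single_path:
  "weighted_chain_sum n M (single_path_sum j) =
     (\<Sum>i\<le>n. (- 1) ^ i * (\<Prod>t<i. single_path_sum 0 (M + Suc t))
        * single_path_sum (j + Suc i) (M + Suc i)
        * chain_sum (n - i) (M + Suc i) (M + Suc i) (M + Suc i))"
proof (induction n arbitrary: M j)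
  case 0
  show ?case by (simp add: weighted_chain_sum_def)
next
  case (Suc n)
  have "weighted_chain_sum (Suc n) M (single_path_sum j)
      = single_path_sum (Suc j) (Suc M) * chain_sum (Suc n) (Suc M) (Suc M) (Suc M)
        - single_path_sum 0 (Suc M) * weighted_chain_sum n (Suc M) (single_path_sum (Suc j))"
  proof -
    have "(\<lambda>y'. \<Sum>z<y' - 1. \<Sum>y\<le>z. single_path_sum j y * q ^ (z - y)) = single_path_sum (Suc j)"
      by (rule ext) simp
    then show ?thesis by (subst weighted_chain_sum_Suc) (simp del: chain_sum.simps)
  qed
  then show ?case
    by (subst sum.atMost_Suc_shift, subst (asm) Suc.IH)
       (simp add: sum_distrib_left sum_negf prod.lessThan_Suc_shift mult_ac
         del: chain_sum.simps single_path_sum.simps prod.lessThan_Suc)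
qed

lemma chain_sum_recurrence:
  "chain_sum (Suc n) M M M =
     (\<Sum>i\<le>n. (- 1) ^ i * (\<Prod>t<i. single_path_sum 0 (M + Suc t))
        * single_path_sum (Suc i) (M + Suc i)
        * chain_sum (n - i) (M + Suc i) (M + Suc i) (M + Suc i))"
  using weighted_chain_sum_single_path[of n M 0]
  by (simp add: chain_sum_Suc_free del: chain_sum.simps single_path_sum.simps)

section \<open>Recurrences for single paths and their generating polynomial\<close>

lemma single_path_sum_0_rec:
  "single_path_sum 0 (Suc (Suc k)) = (1 + q) * single_path_sum 0 (Suc k) - q * single_path_sum 0 k"
  by (simp add: column_weight_def algebra_simps)

text \<open>The increments in \<open>k\<close> are the inner sums over \<open>y\<close>, and such a
  sum is \<open>q\<close> times its predecessor plus the new term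
  \<open>single_path_sum j k\<close>.\<close>

lemma single_path_sum_Suc_rec:
  "single_path_sum (Suc j) (Suc (Suc k)) = (1 + q) * single_path_sum (Suc j) (Suc k)
     - q * single_path_sum (Suc j) k + single_path_sum j k"
proof (cases k)
  case (Suc l)
  have "(\<Sum>y\<le>Suc l. single_path_sum j y * q ^ (Suc l - y))
      = q * (\<Sum>y\<le>l. single_path_sum j y * q ^ (l - y)) + single_path_sum j (Suc l)"
    by (auto simp: sum_distrib_left Suc_diff_le mult_ac intro!: sum.cong)
  then show ?thesis using Suc by (simp add: algebra_simps)
qed simp

text \<open>The end point would lie below the starting point. This makes truncated exponents and
  surplus summands harmless below.\<close>

lemma single_path_sum_eq_0: "k < 2 * j \<Longrightarrow> single_path_sum j k = 0"
proof (induction j arbitrary: k)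
  case (Suc j)
  then show ?case by (auto intro!: sum.neutral simp: Suc.IH)
qed simp

text \<open>For \<kappa> = q and \<open>u = y^2\<close> this becomes \<open>y^k\<close> times the
  complete homogeneous polynomial of degree \<open>k\<close> in \<open>a\<close> and
  \<open>b\<close>, if \<open>a + b = (1 + q) y\<close> and \<open>a b = q y^2 - x\<close>.\<close>

definition path_polynomial :: "'a \<Rightarrow> 'a \<Rightarrow> nat \<Rightarrow> 'a" where
  "path_polynomial x u k = (\<Sum>j\<le>k. x ^ j * u ^ (k - j) * single_path_sum j k)"

lemma path_polynomial_rec:
  "path_polynomial x u (Suc (Suc k)) = (1 + q) * u * path_polynomial x u (Suc k)
     - (q * u - x) * u * path_polynomial x u k"
proof -
  let ?s = single_path_sum
  \<comment> \<open>The three products are brought to one shape: the term free of \<open>x\<close>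
    is split off and the rest is a sum over the common range \<open>j \<le> Suc k\<close>, where
    surplus terms vanish.\<close>
  have G1: "path_polynomial x u (Suc k) * u = u ^ Suc (Suc k) * ?s 0 (Suc k)
      + (\<Sum>j\<le>Suc k. x ^ Suc j * u ^ (Suc k - j) * ?s (Suc j) (Suc k))"
    unfolding path_polynomial_def
    by (subst sum.atMost_Suc_shift)
       (simp add: single_path_sum_eq_0 sum_distrib_left sum_distrib_right Suc_diff_le algebra_simps
         del: single_path_sum.simps)
  have G0: "path_polynomial x u k * u * u = u ^ Suc (Suc k) * ?s 0 k
      + (\<Sum>j\<le>Suc k. x ^ Suc j * u ^ (Suc k - j) * ?s (Suc j) k)"
  proof -
    have "path_polynomial x u k = (\<Sum>j\<le>Suc k. x ^ j * u ^ (k - j) * ?s j k)"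
      unfolding path_polynomial_def by (simp add: single_path_sum_eq_0 del: single_path_sum.simps)
    also have "\<dots> = u ^ k * ?s 0 k + (\<Sum>j\<le>k. x ^ Suc j * u ^ (k - Suc j) * ?s (Suc j) k)"
      by (subst sum.atMost_Suc_shift) (simp del: single_path_sum.simps)
    finally have "path_polynomial x u k * u * u = u ^ Suc (Suc k) * ?s 0 k
      + (\<Sum>j\<le>k. x ^ Suc j * u ^ (k - Suc j) * ?s (Suc j) k * u * u)"
      by (simp add: sum_distrib_left sum_distrib_right algebra_simps del: single_path_sum.simps)
    also have "(\<Sum>j\<le>k. x ^ Suc j * u ^ (k - Suc j) * ?s (Suc j) k * u * u)
      = (\<Sum>j\<le>k. x ^ Suc j * u ^ (Suc k - j) * ?s (Suc j) k)"
    proof (rule sum.cong)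
      fix j assume j: "j \<in> {..k}"
      show "x ^ Suc j * u ^ (k - Suc j) * ?s (Suc j) k * u * u
          = x ^ Suc j * u ^ (Suc k - j) * ?s (Suc j) k"
      \<comment> \<open>For \<open>j = k\<close> the exponent \<open>k - Suc j\<close> is truncated
        to 0 and the powers of \<open>u\<close> disagree, but the factor
        \<open>single_path_sum (Suc k) k\<close> is 0.\<close>
      proof (cases "j = k")
        case False
        then have "Suc k - j = Suc (Suc (k - Suc j))" using j by auto
        then show ?thesis by (simp add: mult_ac)
      qed (simp add: single_path_sum_eq_0 del: single_path_sum.simps)
    qed simp
    finally show ?thesis by (simp add: single_path_sum_eq_0 del: single_path_sum.simps)
  qed
  have G2: "x * u * path_polynomial x u k = (\<Sum>j\<le>Suc k. x ^ Suc j * u ^ (Suc k - j) * ?s j k)"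
    unfolding path_polynomial_def
    by (simp add: single_path_sum_eq_0 sum_distrib_left Suc_diff_le mult_ac del: single_path_sum.simps)
  have "path_polynomial x u (Suc (Suc k)) = u ^ Suc (Suc k) * ?s 0 (Suc (Suc k))
      + (\<Sum>j\<le>Suc k. x ^ Suc j * u ^ (Suc k - j) * ?s (Suc j) (Suc (Suc k)))"
    unfolding path_polynomial_def by (subst sum.atMost_Suc_shift) (simp del: single_path_sum.simps)
  also have "\<dots> = (1 + q) * (path_polynomial x u (Suc k) * u) - q * (path_polynomial x u k * u * u)
      + x * u * path_polynomial x u k"
    unfolding G1 G0 G2 single_path_sum_0_rec single_path_sum_Suc_rec
    by (simp add: sum_distrib_left sum.distrib sum_subtractf algebra_simps
         del: single_path_sum.simps sum.atMost_Suc)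
  finally show ?thesis by (simp add: algebra_simps)
qed

end

section \<open>Faulhaber-type formulas\<close>

context
  fixes q \<kappa> :: "'a::field" and m :: nat
  assumes single_path_sum_nonzero: "r \<le> m \<Longrightarrow> single_path_sum q \<kappa> 0 r \<noteq> 0"
begin

text \<open>Coefficients up to sign. The denominator absorbs the products of free columns in the
  chain recurrence; for \<kappa> = q its reciprocal is \<open>[m-i]!/[m+1]!\<close>.\<close>

definition faulhaber_coeff :: "nat \<Rightarrow> 'a" where
  "faulhaber_coeff i = chain_sum q \<kappa> i (m - i) (m - i) (m - i)
     / (\<Prod>t\<le>i. single_path_sum q \<kappa> 0 (m - t))"

text \<open>This is the chain recurrence for \<open>Suc n\<close> paths divided by a common
  denominator, with the left side moved over as the term \<open>i = Suc n\<close>.\<close>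

lemma faulhaber_coeff_orthogonal:
  assumes "Suc n \<le> m"
  shows "(\<Sum>i\<le>Suc n. (- 1) ^ i * faulhaber_coeff i * single_path_sum q \<kappa> (Suc n - i) (m - i)) = 0"
proof -
  let ?s = "single_path_sum q \<kappa>"
  define M where "M = m - Suc n"
  define W where "W = (\<Prod>t\<le>n. ?s 0 (m - t))"
  have W: "W \<noteq> 0" by (simp add: W_def single_path_sum_nonzero del: single_path_sum.simps)
  \<comment> \<open>The common denominator consists of the denominator of the \<open>i\<close>-th
    coefficient and the free columns that the recurrence attaches to it.\<close>
  have split: "W = (\<Prod>t\<le>i. ?s 0 (m - t)) * (\<Prod>t<n - i. ?s 0 (M + Suc t))" if "i \<le> n" for i
  proof -
    have "{..n} = {..i} \<union> {Suc i..n}" using that by auto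
    moreover have "{..i} \<inter> {Suc i..n} = {}" by auto
    moreover have "(\<Prod>t<n - i. ?s 0 (M + Suc t)) = (\<Prod>t\<in>{Suc i..n}. ?s 0 (m - t))"
      by (rule prod.reindex_bij_witness[of _ "\<lambda>t. n - t" "\<lambda>t. n - t"])
         (use assms in \<open>auto simp: M_def Suc_diff_Suc simp del: single_path_sum.simps\<close>)
    ultimately show ?thesis by (simp add: W_def prod.union_disjoint del: single_path_sum.simps)
  qed
  have "chain_sum q \<kappa> (Suc n) M M M = (\<Sum>i\<le>n. (- 1) ^ (n - i)
        * (\<Prod>t<n - i. ?s 0 (M + Suc t)) * ?s (Suc (n - i)) (m - i)
        * chain_sum q \<kappa> i (m - i) (m - i) (m - i))"
    by (subst chain_sum_recurrence, rule sum.reindex_bij_witness[of _ "\<lambda>t. n - t" "\<lambda>t. n - t"])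
       (use assms in \<open>auto simp: M_def Suc_diff_le Suc_diff_Suc simp del: single_path_sum.simps chain_sum.simps\<close>)
  also have "\<dots> = (\<Sum>i\<le>n. (- 1) ^ (n - i) * ?s (Suc n - i) (m - i) * (W * faulhaber_coeff i))"
  proof (rule sum.cong)
    fix i assume "i \<in> {..n}"
    then have "W * faulhaber_coeff i = (\<Prod>t<n - i. ?s 0 (M + Suc t))
        * chain_sum q \<kappa> i (m - i) (m - i) (m - i)"
      using assms
      by (simp add: split[of i] faulhaber_coeff_def single_path_sum_nonzero
          del: single_path_sum.simps chain_sum.simps)
    then show "(- 1) ^ (n - i) * (\<Prod>t<n - i. ?s 0 (M + Suc t)) * ?s (Suc (n - i)) (m - i)
        * chain_sum q \<kappa> i (m - i) (m - i) (m - i)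
        = (- 1) ^ (n - i) * ?s (Suc n - i) (m - i) * (W * faulhaber_coeff i)"
      using \<open>i \<in> {..n}\<close> by (simp add: Suc_diff_le mult_ac del: single_path_sum.simps chain_sum.simps)
  qed simp
  also have "\<dots> = W * (- 1) ^ n *
      (\<Sum>i\<le>n. (- 1) ^ i * faulhaber_coeff i * ?s (Suc n - i) (m - i))"
    unfolding sum_distrib_left
  proof (rule sum.cong)
    fix i assume "i \<in> {..n}"
    then have "(- 1 :: 'a) ^ (n - i) = (- 1) ^ n * (- 1) ^ i"
      by (auto simp: minus_one_power_iff)
    then show "(- 1) ^ (n - i) * ?s (Suc n - i) (m - i) * (W * faulhaber_coeff i)
        = W * (- 1) ^ n * ((- 1) ^ i * faulhaber_coeff i * ?s (Suc n - i) (m - i))"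
      by (simp add: mult_ac del: single_path_sum.simps)
  qed simp
  finally have "chain_sum q \<kappa> (Suc n) M M M = W * (- 1) ^ n *
      (\<Sum>i\<le>n. (- 1) ^ i * faulhaber_coeff i * ?s (Suc n - i) (m - i))" .
  \<comment> \<open>\<open>W\<close> lacks the last denominator factor,
    \<open>?s 0 (m - Suc n)\<close>, which is just the factor that the term \<open>i = Suc n\<close>
    carries.\<close>
  moreover have "chain_sum q \<kappa> (Suc n) M M M = W * (?s 0 (m - Suc n) * faulhaber_coeff (Suc n))"
    using W assms by (simp add: M_def faulhaber_coeff_def W_def single_path_sum_nonzero
        del: single_path_sum.simps chain_sum.simps)
  ultimately have "?s 0 (m - Suc n) * faulhaber_coeff (Suc n)
      = (- 1) ^ n * (\<Sum>i\<le>n. (- 1) ^ i * faulhaber_coeff i * ?s (Suc n - i) (m - i))"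
    using W by (simp add: mult.assoc del: single_path_sum.simps chain_sum.simps)
  then show ?thesis
    by (simp add: mult_ac minus_one_power_iff del: single_path_sum.simps chain_sum.simps)
qed

text \<open>Collect the coefficient of \<open>x^l * u^(m - l)\<close>: for \<open>l = 0\<close> it
  is 1, and for \<open>l > 0\<close> it vanishes by orthogonality.\<close>

lemma faulhaber_coeff_sum:
  "(\<Sum>i\<le>m. (- x) ^ i * faulhaber_coeff i * path_polynomial q \<kappa> x u (m - i)) = u ^ m"
proof -
  let ?s = "single_path_sum q \<kappa>"
  let ?t = "\<lambda>i l. x ^ l * u ^ (m - l) * ((- 1) ^ i * faulhaber_coeff i * ?s (l - i) (m - i))"
  have "(\<Sum>i\<le>m. (- x) ^ i * faulhaber_coeff i * path_polynomial q \<kappa> x u (m - i))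
      = (\<Sum>i\<le>m. \<Sum>j\<le>m - i. ?t i (i + j))"
    unfolding path_polynomial_def sum_distrib_left
    by (intro sum.cong refl)
       (simp add: power_minus[of x] power_add mult_ac diff_diff_left del: single_path_sum.simps)
  also have "\<dots> = (\<Sum>i\<le>m. \<Sum>l\<in>{i..m}. ?t i l)"
  proof (rule sum.cong)
    fix i assume "i \<in> {..m}"
    then show "(\<Sum>j\<le>m - i. ?t i (i + j)) = (\<Sum>l\<in>{i..m}. ?t i l)"
      by (intro sum.reindex_bij_witness[of _ "\<lambda>l. l - i" "\<lambda>j. i + j"]) auto
  qed simp
  also have "\<dots> = (\<Sum>l\<le>m. \<Sum>i\<le>l. ?t i l)"
    by (subst (1 2) sum.Sigma; force intro!: sum.reindex_bij_witness[of _ prod.swap prod.swap])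
  also have "\<dots> = (\<Sum>l\<le>m. if l = 0 then u ^ m else 0)"
  proof (rule sum.cong)
    fix l assume l: "l \<in> {..m}"
    show "(\<Sum>i\<le>l. ?t i l) = (if l = 0 then u ^ m else 0)"
    proof (cases l)
      case 0
      then show ?thesis
        using single_path_sum_nonzero[of m]
        by (simp add: faulhaber_coeff_def del: single_path_sum.simps)
    next
      case (Suc n)
      then show ?thesis
        using faulhaber_coeff_orthogonal[of n] l by (simp only: flip: sum_distrib_left) simp
    qed
  qed simp
  also have "\<dots> = u ^ m" by simp
  finally show ?thesis .
qed

text \<open>With \<open>u = y^2\<close> the path polynomial obeys the linear recurrence with roots
  \<open>a * y\<close> and \<open>b * y\<close>. The conditions on \<open>A\<close> and
  \<open>B\<close> match the initial values at degrees 0 and 1; keeping them free covers both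
  parities of the exponent.\<close>

lemma faulhaber_coeff_closed_form:
  assumes "a + b = (1 + q) * y" "a * b = q * y\<^sup>2 - x"
    and "A - B = D" "A * a - B * b = D * (1 + \<kappa>) * y"
  shows "(\<Sum>i\<le>m. (- x) ^ i * faulhaber_coeff i * (y ^ (m - i) * (A * a ^ (m - i) - B * b ^ (m - i))))
    = D * (y\<^sup>2) ^ m"
proof -
  have "D * path_polynomial q \<kappa> x (y\<^sup>2) k = y ^ k * (A * a ^ k - B * b ^ k)
     \<and> D * path_polynomial q \<kappa> x (y\<^sup>2) (Suc k) = y ^ Suc k * (A * a ^ Suc k - B * b ^ Suc k)" for k
  proof (induction k)
    case 0
    have "path_polynomial q \<kappa> x (y\<^sup>2) (Suc 0) = (1 + \<kappa>) * y\<^sup>2"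
      by (simp add: path_polynomial_def column_weight_def algebra_simps)
    then show ?case using assms
      by (simp add: path_polynomial_def column_weight_def power2_eq_square)
  next
    case (Suc k)
    have "D * path_polynomial q \<kappa> x (y\<^sup>2) (Suc (Suc k))
      = (1 + q) * y * y * (D * path_polynomial q \<kappa> x (y\<^sup>2) (Suc k))
        - (q * y\<^sup>2 - x) * y * y * (D * path_polynomial q \<kappa> x (y\<^sup>2) k)"
      by (simp add: path_polynomial_rec power2_eq_square algebra_simps)
    also have "\<dots> = (a + b) * y * (y ^ Suc k * (A * a ^ Suc k - B * b ^ Suc k))
        - a * b * y * y * (y ^ k * (A * a ^ k - B * b ^ k))"
      using Suc.IH by (simp only: assms(1,2))
    also have "\<dots> = y ^ Suc (Suc k) * (A * a ^ Suc (Suc k) - B * b ^ Suc (Suc k))"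
      by (simp add: algebra_simps)
    finally show ?case using Suc.IH by blast
  qed
  then have "(\<Sum>i\<le>m. (- x) ^ i * faulhaber_coeff i * (y ^ (m - i) * (A * a ^ (m - i) - B * b ^ (m - i))))
      = (\<Sum>i\<le>m. D * ((- x) ^ i * faulhaber_coeff i * path_polynomial q \<kappa> x (y\<^sup>2) (m - i)))"
    by (intro sum.cong refl) (simp only: mult.left_commute[of D])
  then show ?thesis by (simp only: faulhaber_coeff_sum flip: sum_distrib_left)
qed

end

section \<open>q-integers and the recursion of the power sums\<close>

lemma qint_pos: "0 < q \<Longrightarrow> q < 1 \<Longrightarrow> 0 < k \<Longrightarrow> 0 < qint q k"
  using power_less_one_iff[of q k] by (simp add: qint_def)

lemma qint_less_Suc: "0 < q \<Longrightarrow> q < 1 \<Longrightarrow> qint q k < qint q (Suc k)"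
  by (simp add: qint_def divide_strict_right_mono)

lemma qint_add_neighbours:
  "q \<noteq> 1 \<Longrightarrow> qint q (Suc (Suc n)) + q * qint q n = (1 + q) * qint q (Suc n)"
  by (simp add: qint_def divide_simps) (simp add: algebra_simps)

lemma qint_mult_neighbours:
  "q \<noteq> 1 \<Longrightarrow> qint q (Suc (Suc n)) * (q * qint q n) = q * (qint q (Suc n))\<^sup>2 - q ^ Suc n"
  by (simp add: qint_def divide_simps power2_eq_square) (simp add: algebra_simps)

lemma qint_double: "q \<noteq> 1 \<Longrightarrow> qint q (2 * n) = qint q n * (1 + q ^ n)"
  by (simp add: qint_def divide_simps) (simp add: algebra_simps power_mult power2_eq_square)

lemma single_path_sum_qint:
  assumes "q \<noteq> 1"
  shows "single_path_sum q q 0 r = qint q (Suc r)"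
proof -
  have "column_weight q q x = q ^ x" for x
    by (cases x) (simp_all add: column_weight_def)
  then show ?thesis
    using assms by (simp add: qint_def sum_gp0)
qed

text \<open>The column weight at \<open>r + 1\<close> is \<open>p^(2r+1) + p^(2r+2)\<close>, so each
  further height adds the next two powers of \<open>p\<close>.\<close>

lemma single_path_sum_odd_qint:
  assumes "p \<noteq> (1::real)"
  shows "single_path_sum (p\<^sup>2) (p\<^sup>2 + p) 0 r = qint p (Suc (2 * r))"
proof -
  have "single_path_sum (p\<^sup>2) (p\<^sup>2 + p) 0 r * (1 - p) = 1 - p ^ Suc (2 * r)"
  proof (induction r)
    case (Suc r)
    have "column_weight (p\<^sup>2) (p\<^sup>2 + p) (Suc r) = (p\<^sup>2 + p) * p ^ (2 * r)"
      by (simp add: column_weight_def power_mult)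
    then show ?case
      using Suc.IH by (simp add: algebra_simps power2_eq_square)
  qed (simp add: column_weight_def)
  then show ?thesis using assms by (simp add: qint_def eq_divide_eq del: single_path_sum.simps)
qed

lemma S_sum_Suc:
  assumes "0 \<le> q" "0 < l"
  shows "S_sum q l (Suc n) = sqrt q ^ Suc l * S_sum q l n
    + qint q (2 * Suc n) / qint q 2 * qint q (Suc n) ^ (l - 1)"
proof -
  have "sqrt q ^ ((l + 1) * (Suc n - k)) = sqrt q ^ Suc l * sqrt q ^ ((l + 1) * (n - k))"
    if "k \<in> {1..n}" for k
  proof -
    have "(l + 1) * (Suc n - k) = Suc l + (l + 1) * (n - k)"
      using that by (simp add: Suc_diff_le)
    then show ?thesis by (simp only: power_add)
  qed
  then have "(\<Sum>k = 1..n. qint q (2 * k) / qint q 2 * qint q k ^ (l - 1)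
                      * sqrt q ^ ((l + 1) * (Suc n - k)))
    = sqrt q ^ Suc l * S_sum q l n"
    unfolding S_sum_def sum_distrib_left
    by (intro sum.cong refl) (simp only: mult_ac)
  then show ?thesis unfolding S_sum_def by simp
qed

text \<open>Cancelling factorials turns the normalisation in the definition of the \<open>P\<close>
  polynomials into the denominator of \<open>faulhaber_coeff\<close>.\<close>

lemma qfact_ratio:
  assumes "0 < q" "q < 1" "i \<le> m"
  shows "qfact q (m - i) / qfact q (m + 1) = 1 / (\<Prod>t\<le>i. qint q (Suc (m - t)))"
  using assms(3)
proof (induction i)
  case 0
  have "qfact q m \<noteq> 0" unfolding qfact_def using qint_pos[OF assms(1,2)] by (auto simp: less_imp_neq[symmetric] dest: less_imp_neq)
  then show ?case by (simp add: qfact_def)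
next
  case (Suc i)
  then have "m - i = Suc (m - Suc i)" by simp
  then have "qfact q (m - i) = qfact q (m - Suc i) * qint q (Suc (m - Suc i))"
    by (simp add: qfact_def)
  moreover have "qint q (Suc (m - Suc i)) \<noteq> 0"
    using qint_pos[OF assms(1,2), of "Suc (m - Suc i)"] by simp
  ultimately have "qfact q (m - Suc i) / qfact q (m + 1)
      = qfact q (m - i) / qfact q (m + 1) / qint q (Suc (m - Suc i))"
    by simp
  also have "\<dots> = 1 / (\<Prod>t\<le>i. qint q (Suc (m - t))) / qint q (Suc (m - Suc i))"
    using Suc by simp
  finally show ?case by simp
qed

text \<open>Induction on \<open>n\<close>: the right side at \<open>Suc n\<close> minus
  \<open>q^(m+1)\<close> times the right side at \<open>n\<close> is evaluated by the closed form
  with \<open>A = a\<close> and \<open>B = b\<close>, and equals the new summand.\<close>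

lemma S_sum_odd:
  fixes q :: real
  assumes q: "0 < q" "q < 1"
  shows "S_sum q (2 * m + 1) n = (\<Sum>i\<le>m. (- (q ^ n)) ^ i * faulhaber_coeff q q m i
     * (qint q n * qint q (n + 1)) ^ Suc (m - i)) / qint q 2"
proof (induction n)
  case 0
  show ?case by (simp add: S_sum_def qint_def)
next
  case (Suc n)
  define x y a b where "x = q ^ Suc n" and "y = qint q (Suc n)" and "a = qint q (Suc (Suc n))"
    and "b = q * qint q n"
  let ?d = "faulhaber_coeff q q m"
  have nz: "single_path_sum q q 0 r \<noteq> 0" for r
    using qint_pos[OF q, of "Suc r"] q by (subst single_path_sum_qint) auto
  have q1: "1 - q \<noteq> 0" using q by simp
  have e1: "a + b = (1 + q) * y" and e2: "a * b = q * y\<^sup>2 - x"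
    and e4: "qint q (2 * Suc n) = y * (1 + x)"
    using q qint_add_neighbours[of q n] qint_mult_neighbours[of q n] qint_double[of q "Suc n"]
    by (simp_all add: a_def b_def y_def x_def del: mult_Suc_right power_Suc)
  have e3: "a - b = 1 + x"
    using q1 by (simp add: a_def b_def x_def qint_def divide_simps) (simp add: algebra_simps)
  have "a * a - b * b = (a - b) * (a + b)"
    by (simp add: algebra_simps)
  then have e5: "a * a - b * b = (1 + x) * (1 + q) * y"
    by (simp only: e1 e3 mult.assoc)
  have sq: "sqrt q ^ Suc (2 * m + 1) = q ^ Suc m"
    using q by (simp add: power_mult)
  \<comment> \<open>Of the \<open>m + 1\<close> factors \<open>q\<close>, \<open>i\<close> turn
    \<open>q^n\<close> into \<open>x\<close> and the other \<open>m - i + 1\<close> turn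
    \<open>[n]\<close> into \<open>b\<close>.\<close>
  have "q ^ Suc m * (\<Sum>i\<le>m. (- (q ^ n)) ^ i * ?d i * (qint q n * y) ^ Suc (m - i))
      = (\<Sum>i\<le>m. (- x) ^ i * ?d i * (b * y) ^ Suc (m - i))"
    unfolding sum_distrib_left
  proof (rule sum.cong)
    fix i assume "i \<in> {..m}"
    then have "q ^ Suc m = q ^ i * q ^ Suc (m - i)" by (simp flip: power_add)
    moreover have "(- x) ^ i = q ^ i * (- (q ^ n)) ^ i"
      by (simp add: x_def flip: power_mult_distrib)
    ultimately show "q ^ Suc m * ((- (q ^ n)) ^ i * ?d i * (qint q n * y) ^ Suc (m - i))
      = (- x) ^ i * ?d i * (b * y) ^ Suc (m - i)"
      using q by (simp add: b_def power_mult_distrib)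
  qed simp
  moreover have "(\<Sum>i\<le>m. (- x) ^ i * ?d i * (y * a) ^ Suc (m - i))
      - (\<Sum>i\<le>m. (- x) ^ i * ?d i * (b * y) ^ Suc (m - i))
      = y * (\<Sum>i\<le>m. (- x) ^ i * ?d i * (y ^ (m - i) * (a * a ^ (m - i) - b * b ^ (m - i))))"
    by (simp add: sum_distrib_left algebra_simps flip: sum_subtractf)
  moreover have "\<dots> = y * ((1 + x) * (y\<^sup>2) ^ m)"
    by (simp only: faulhaber_coeff_closed_form[OF nz e1 e2 e3 e5])
  ultimately have step: "(\<Sum>i\<le>m. (- x) ^ i * ?d i * (y * a) ^ Suc (m - i))
     = q ^ Suc m * (\<Sum>i\<le>m. (- (q ^ n)) ^ i * ?d i * (qint q n * y) ^ Suc (m - i))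
       + y * ((1 + x) * (y\<^sup>2) ^ m)"
    by linarith
  have "S_sum q (2 * m + 1) (Suc n) = q ^ Suc m * S_sum q (2 * m + 1) n
      + y * (1 + x) / qint q 2 * (y\<^sup>2) ^ m"
    using S_sum_Suc[of q "2 * m + 1" n] q unfolding e4 y_def[symmetric]
    by (simp only: sq) (simp add: power_mult)
  also have "\<dots> = (q ^ Suc m * (\<Sum>i\<le>m. (- (q ^ n)) ^ i * ?d i * (qint q n * y) ^ Suc (m - i))
       + y * ((1 + x) * (y\<^sup>2) ^ m)) / qint q 2"
    unfolding Suc.IH by (simp add: y_def add_divide_distrib mult_ac)
  also have "\<dots> = (\<Sum>i\<le>m. (- x) ^ i * ?d i * (y * a) ^ Suc (m - i)) / qint q 2"
    unfolding step ..
  finally show ?case by (simp add: x_def y_def a_def)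
qed

text \<open>Same induction, written in \<open>p\<close>, the square root of the base, so that
  half-integral powers become integral ones.\<close>

lemma S_sum_even:
  fixes p :: real
  assumes p: "0 < p" "p < 1" and m: "1 \<le> m"
  shows "S_sum (p\<^sup>2) (2 * m) n = (1 - (p\<^sup>2) ^ n * p) *
     (\<Sum>i\<le>m. (- ((p\<^sup>2) ^ n)) ^ i * faulhaber_coeff (p\<^sup>2) (p\<^sup>2 + p) m i
       * (qint (p\<^sup>2) n * qint (p\<^sup>2) (n + 1)) ^ (m - i)) / (1 - p) / qint (p\<^sup>2) 2"
proof (induction n)
  case 0
  \<comment> \<open>At \<open>n = 0\<close> the term \<open>i = m\<close> contains
    \<open>[0]^0 = 1\<close>. Its coefficient vanishes for \<open>m \<ge> 1\<close>, as no final
    height lies below 0.\<close>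
  have "faulhaber_coeff (p\<^sup>2) (p\<^sup>2 + p) m m = 0"
  proof -
    have "single_path_sum (p\<^sup>2) (p\<^sup>2 + p) 0 r \<noteq> 0" for r
      using qint_pos[OF p, of "Suc (2 * r)"] p by (subst single_path_sum_odd_qint) auto
    then show ?thesis
      using m by (cases m) (simp_all add: faulhaber_coeff_def)
  qed
  then have "(\<Sum>i\<le>m. (- 1) ^ i * faulhaber_coeff (p\<^sup>2) (p\<^sup>2 + p) m i * 0 ^ (m - i)) = 0"
    by (intro sum.neutral ballI) (auto simp: power_0_left)
  then show ?case by (simp add: S_sum_def qint_def)
next
  case (Suc n)
  define q where "q = p\<^sup>2"
  have q: "0 < q" "q < 1" using p by (auto simp: q_def power_less_one_iff)
  define x y a b where "x = q ^ Suc n" and "y = qint q (Suc n)" and "a = qint q (Suc (Suc n))"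
    and "b = q * qint q n"
  let ?d = "faulhaber_coeff q (q + p) m"
  have nz: "single_path_sum q (q + p) 0 r \<noteq> 0" for r
    using qint_pos[OF p, of "Suc (2 * r)"] p unfolding q_def by (subst single_path_sum_odd_qint) auto
  have q1: "1 - q \<noteq> 0" using q by simp
  have e1: "a + b = (1 + q) * y" and e2: "a * b = q * y\<^sup>2 - x"
    and e4: "qint q (2 * Suc n) = y * (1 + x)"
    using q qint_add_neighbours[of q n] qint_mult_neighbours[of q n] qint_double[of q "Suc n"]
    by (simp_all add: a_def b_def y_def x_def del: mult_Suc_right power_Suc)
  \<comment> \<open>\<open>A = 1 - x * p\<close> is the prefactor at \<open>Suc n\<close>, and
    \<open>B = p - x\<close> is \<open>p\<close> times the prefactor at \<open>n\<close>; the extra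
    \<open>p\<close> comes from the odd power \<open>p^(2m+1)\<close>.\<close>
  have e3: "(1 - x * p) - (p - x) = (1 - p) * (1 + x)"
    by (simp add: algebra_simps)
  have e5: "(1 - x * p) * a - (p - x) * b = (1 - p) * (1 + x) * (1 + (q + p)) * y"
  proof -
    \<comment> \<open>After multiplication by \<open>1 - q\<close> the q-integers are linear in
      \<open>x\<close>, and the claim is a polynomial identity in \<open>p\<close> and
      \<open>x\<close>.\<close>
    have "a * (1 - q) = 1 - q * x" "b * (1 - q) = q - x" "y * (1 - q) = 1 - x"
      using q1 by (simp_all add: a_def b_def y_def x_def qint_def) (simp_all add: algebra_simps)
    then have "((1 - x * p) * a - (p - x) * b) * (1 - q)
        = (1 - x * p) * (1 - q * x) - (p - x) * (q - x)"
      "(1 - p) * (1 + x) * (1 + (q + p)) * y * (1 - q) = (1 - p) * (1 + x) * (1 + (q + p)) * (1 - x)"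
      by (simp_all add: left_diff_distrib mult.assoc)
    moreover have "(1 - x * p) * (1 - q * x) - (p - x) * (q - x)
        = (1 - p) * (1 + x) * (1 + (q + p)) * (1 - x)"
      unfolding q_def by (simp add: algebra_simps power2_eq_square)
    ultimately show ?thesis using q1 by (metis mult_right_cancel)
  qed
  have "p ^ Suc (2 * m) * ((1 - q ^ n * p) *
        (\<Sum>i\<le>m. (- (q ^ n)) ^ i * ?d i * (qint q n * y) ^ (m - i)))
      = (p - x) * (\<Sum>i\<le>m. (- x) ^ i * ?d i * (b * y) ^ (m - i))"
    unfolding sum_distrib_left
  proof (rule sum.cong)
    fix i assume "i \<in> {..m}"
    then have "2 * m = 2 * i + 2 * (m - i)" by simp
    then have "p ^ Suc (2 * m) = p * q ^ i * q ^ (m - i)"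
      by (simp only: q_def power_Suc power_add power_mult mult.assoc)
    moreover have "(- x) ^ i = q ^ i * (- (q ^ n)) ^ i"
      by (simp add: x_def flip: power_mult_distrib)
    moreover have "p - x = p * (1 - q ^ n * p)"
      by (simp add: x_def q_def algebra_simps power2_eq_square)
    ultimately show "p ^ Suc (2 * m) *
          ((1 - q ^ n * p) * ((- (q ^ n)) ^ i * ?d i * (qint q n * y) ^ (m - i)))
      = (p - x) * ((- x) ^ i * ?d i * (b * y) ^ (m - i))"
      using p by (simp add: b_def power_mult_distrib)
  qed simp
  moreover have "(1 - x * p) * (\<Sum>i\<le>m. (- x) ^ i * ?d i * (y * a) ^ (m - i))
      - (p - x) * (\<Sum>i\<le>m. (- x) ^ i * ?d i * (b * y) ^ (m - i))
      = (\<Sum>i\<le>m. (- x) ^ i * ?d i * (y ^ (m - i) *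
          ((1 - x * p) * a ^ (m - i) - (p - x) * b ^ (m - i))))"
    unfolding sum_distrib_left sum_subtractf[symmetric]
    by (intro sum.cong refl) (simp add: power_mult_distrib right_diff_distrib mult_ac)
  moreover have "\<dots> = (1 - p) * (1 + x) * (y\<^sup>2) ^ m"
    by (rule faulhaber_coeff_closed_form[OF nz e1 e2 e3 e5])
  ultimately have step: "(1 - x * p) * (\<Sum>i\<le>m. (- x) ^ i * ?d i * (y * a) ^ (m - i))
     = p ^ Suc (2 * m) * ((1 - q ^ n * p) *
        (\<Sum>i\<le>m. (- (q ^ n)) ^ i * ?d i * (qint q n * y) ^ (m - i)))
       + (1 - p) * (1 + x) * (y\<^sup>2) ^ m"
    by linarith
  have y2: "(y\<^sup>2) ^ m = y * y ^ (2 * m - 1)"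
    using m by (simp flip: power_mult power_Suc)
  have "S_sum q (2 * m) (Suc n) = p ^ Suc (2 * m) * S_sum q (2 * m) n
      + y * (1 + x) / qint q 2 * y ^ (2 * m - 1)"
    using S_sum_Suc[of q "2 * m" n] m p q e4 by (simp add: q_def y_def real_sqrt_abs)
  also have "\<dots> = (p ^ Suc (2 * m) * ((1 - q ^ n * p) *
        (\<Sum>i\<le>m. (- (q ^ n)) ^ i * ?d i * (qint q n * y) ^ (m - i)))
       + (1 - p) * (1 + x) * (y\<^sup>2) ^ m) / (1 - p) / qint q 2"
    using Suc.IH p unfolding y2 by (simp add: q_def y_def add_divide_distrib mult_ac)
  also have "\<dots> = (1 - x * p) * (\<Sum>i\<le>m. (- x) ^ i * ?d i * (y * a) ^ (m - i)) / (1 - p) / qint q 2"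
    unfolding step ..
  finally show ?case by (simp add: q_def x_def y_def a_def)
qed

section \<open>Uniqueness of the coefficient polynomials\<close>

abbreviation eval_int_poly :: "real \<Rightarrow> int poly \<Rightarrow> real" where
  "eval_int_poly r p \<equiv> poly (map_poly of_int p) r"

lemma eval_int_poly_add: "eval_int_poly r (p + s) = eval_int_poly r p + eval_int_poly r s"
proof -
  have "map_poly of_int (p + s) = (map_poly of_int p + map_poly of_int s :: real poly)"
    by (intro poly_eqI) (simp add: coeff_map_poly)
  then show ?thesis by simp
qed

lemma eval_int_poly_mult: "eval_int_poly r (p * s) = eval_int_poly r p * eval_int_poly r s"
proof -
  have "map_poly of_int (p * s) = (map_poly of_int p * map_poly of_int s :: real poly)"
    by (intro poly_eqI) (simp add: coeff_map_poly coeff_mult)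
  then show ?thesis by simp
qed

lemma eval_int_poly_power: "eval_int_poly r (p ^ n) = eval_int_poly r p ^ n"
  by (induction n) (simp_all add: eval_int_poly_mult)

lemma eval_int_poly_sum: "eval_int_poly r (\<Sum>i\<in>A. f i) = (\<Sum>i\<in>A. eval_int_poly r (f i))"
  by (induction A rule: infinite_finite_induct) (simp_all add: eval_int_poly_add)

lemma eval_int_poly_chain_sum:
  "eval_int_poly r (chain_sum q \<kappa> n M b c)
   = chain_sum (eval_int_poly r q) (eval_int_poly r \<kappa>) n M b c"
proof (induction n arbitrary: M b c)
  case (Suc n)
  have "eval_int_poly r (column_weight q \<kappa> x)
      = column_weight (eval_int_poly r q) (eval_int_poly r \<kappa>) x" for x
    by (simp add: column_weight_def eval_int_poly_mult eval_int_poly_power)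
  then show ?case
    by (auto simp: eval_int_poly_sum eval_int_poly_mult eval_int_poly_power Suc.IH intro!: sum.cong)
qed simp

lemma int_poly_eq_if_eval_eq:
  assumes "\<And>r. 0 < r \<Longrightarrow> r < 1 \<Longrightarrow> eval_int_poly r p = eval_int_poly r s"
  shows "p = s"
proof -
  have "{0<..<1} \<subseteq> {r. poly (map_poly of_int p - map_poly of_int s) r = (0::real)}"
    using assms by auto
  moreover have "infinite {0<..<1::real}" by (simp add: infinite_Ioo)
  ultimately have "infinite {r. poly (map_poly of_int p - map_poly of_int s) r = (0::real)}"
    by (rule infinite_super)
  then have "map_poly of_int p - map_poly of_int s = (0 :: real poly)"
    using poly_roots_finite by blast
  then have "coeff (map_poly of_int p) i = (coeff (map_poly of_int s) i :: real)" for i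
    by simp
  then show ?thesis by (intro poly_eqI) (simp add: coeff_map_poly)
qed

text \<open>Divided by the \<open>m\<close>-th power of \<open>[n][n+1]\<close>, the sum is a
  polynomial with coefficients \<open>e i\<close> at \<open>-q^n/([n][n+1])\<close>. These points
  strictly increase with \<open>n\<close>, so the polynomial has infinitely many roots.\<close>

lemma faulhaber_basis_independent:
  assumes q: "0 < q" "q < (1::real)"
    and zero: "\<And>n. 1 \<le> n \<Longrightarrow>
      (\<Sum>i\<le>m. (- (q ^ n)) ^ i * e i * (qint q n * qint q (n + 1)) ^ (m - i)) = 0"
    and "i \<le> m"
  shows "e i = 0"
proof -
  \<comment> \<open>Indices are shifted by one: the hypothesis starts at \<open>n = 1\<close>, where
    \<open>[n]\<close> is positive.\<close>
  define w where "w n = qint q (Suc n) * qint q (Suc (Suc n))" for n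
  define t where "t n = q ^ Suc n / w n" for n
  define P where "P = (\<Sum>i\<le>m. monom (e i) i)"
  have w: "0 < w n" for n
    unfolding w_def by (intro mult_pos_pos qint_pos q) auto
  have "t (Suc n) < t n" for n
  proof -
    have "w n < w (Suc n)"
      unfolding w_def using qint_pos[OF q, of "Suc n"] qint_less_Suc[OF q]
      by (intro mult_strict_mono qint_pos[OF q]) (auto intro: less_imp_le qint_pos[OF q])
    then show ?thesis
      unfolding t_def using q w[of n] by (intro frac_less2) (auto intro: mult_left_le_one_le)
  qed
  then have "strict_mono (\<lambda>n. - t n)" by (simp add: strict_mono_Suc_iff)
  then have "infinite (range (\<lambda>n. - t n))"
    by (intro range_inj_infinite strict_mono_imp_inj_on)
  moreover have "poly P (- t n) = 0" for n
  proof -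
    have "(\<Sum>i\<le>m. (- (q ^ Suc n)) ^ i * e i * w n ^ (m - i)) = w n ^ m * poly P (- t n)"
      unfolding P_def poly_sum sum_distrib_left
    proof (rule sum.cong)
      fix i assume "i \<in> {..m}"
      then have "w n ^ m = w n ^ (m - i) * w n ^ i" by (simp flip: power_add)
      moreover have "w n ^ i * (- t n) ^ i = (- (q ^ Suc n)) ^ i"
        using w[of n] by (simp add: t_def flip: power_mult_distrib)
      ultimately show "(- (q ^ Suc n)) ^ i * e i * w n ^ (m - i) = w n ^ m * poly (monom (e i) i) (- t n)"
        by (simp add: poly_monom mult_ac)
    qed simp
    moreover have "(\<Sum>i\<le>m. (- (q ^ Suc n)) ^ i * e i * w n ^ (m - i)) = 0"
      using zero[of "Suc n"] by (simp add: w_def)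
    ultimately show ?thesis using w[of n] by simp
  qed
  ultimately have "infinite {r. poly P r = 0}"
    by (elim infinite_super[rotated]) auto
  then have "P = 0" using poly_roots_finite by blast
  moreover have "coeff P i = e i"
    using \<open>i \<le> m\<close> by (simp add: P_def coeff_sum)
  ultimately show ?thesis by simp
qed

section \<open>Identification of the polynomials with chain sums\<close>

lemma sum_complement_index:
  "(\<Sum>k = 0..m::nat. f (m - k) k) = (\<Sum>i\<le>m. f i (m - i) :: 'a::comm_monoid_add)"
  by (rule sum.reindex_bij_witness[of _ "\<lambda>i. m - i" "\<lambda>k. m - k"]) auto

text \<open>The chain sums satisfy the defining property by the formula for odd exponents. Any other
  solution agrees with them at every \<open>q\<close> in (0,1) by linear independence, hence as
  polynomials.\<close>

lemma GZ_P_eq: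
  assumes "k \<le> m"
  shows "GZ_P m k = chain_sum [:0, 1:] [:0, 1:] k (m - k) (m - k) (m - k)"
proof -
  \<comment> \<open>Extended by 0 beyond \<open>m\<close>, as the defining property demands, so that
    uniqueness holds for the whole function.\<close>
  define R where "R j = (if j \<le> m then chain_sum [:0, 1:] [:0, 1:] j (m - j) (m - j) (m - j) else 0 :: int poly)"
    for j :: nat
  define c where "c q i = qfact q (m - i) / qfact q (m + 1)" for q i
  have c_pos: "c q i > 0" if "0 < q" "q < 1" "i \<le> m" for q i
    unfolding c_def qfact_ratio[OF that] by (simp add: prod_pos qint_pos that)
  have R: "GZ_P_prop m R"
    unfolding GZ_P_prop_def
  proof (intro conjI allI impI)
    fix n :: nat and q :: real
    assume "1 \<le> n" and q: "0 < q \<and> q < 1"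
    have nz: "single_path_sum q q 0 r \<noteq> 0" for r
      using qint_pos[of q "Suc r"] q by (subst single_path_sum_qint) auto
    have "faulhaber_coeff q q m i = c q i * eval_int_poly q (R i)" if "i \<le> m" for i
    proof -
      have "c q i = 1 / (\<Prod>t\<le>i. qint q (Suc (m - t)))"
        using that q by (simp only: c_def qfact_ratio)
      then show ?thesis
        using that q
        by (simp add: faulhaber_coeff_def[OF nz] R_def eval_int_poly_chain_sum
            single_path_sum_qint map_poly_pCons del: single_path_sum.simps chain_sum.simps)
    qed
    then have "S_sum q (2 * m + 1) n = (\<Sum>i\<le>m. (- (q ^ n)) ^ i * (c q i * eval_int_poly q (R i))
       * (qint q n * qint q (n + 1)) ^ Suc (m - i)) / qint q 2"
      using S_sum_odd[of q m n] q by simp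
    then show "S_sum q (2 * m + 1) n = (\<Sum>k = 0..m. (- (q ^ n)) ^ (m - k) * (qfact q k / qfact q (m + 1))
              * eval_int_poly q (R (m - k)) * (qint q n * qint q (n + 1)) ^ (k + 1) / qint q 2)"
      using sum_complement_index[of "\<lambda>i k. (- (q ^ n)) ^ i * (qfact q k / qfact q (m + 1))
              * eval_int_poly q (R i) * (qint q n * qint q (n + 1)) ^ (k + 1) / qint q 2" m]
      by (simp only: c_def mult.assoc sum_divide_distrib Suc_eq_plus1)
  qed (simp add: R_def)
  have "P = R" if P: "GZ_P_prop m P" for P
  proof
    fix i
    show "P i = R i"
    proof (cases "i \<le> m")
      case True
      show ?thesis
      proof (rule int_poly_eq_if_eval_eq)
        fix q :: real assume q: "0 < q" "q < 1"
        have "c q i * eval_int_poly q (P i) - c q i * eval_int_poly q (R i) = 0"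
        proof (rule faulhaber_basis_independent[OF q _ True])
          fix n :: nat assume n: "1 \<le> n"
          let ?v = "qint q n * qint q (n + 1)"
          have v: "?v \<noteq> 0" using qint_pos[OF q] n by (simp add: less_imp_neq[symmetric])
          \<comment> \<open>Dividing by \<open>?v\<close>, nonzero because \<open>n \<ge> 1\<close>,
            lowers the exponent \<open>k + 1\<close> to the \<open>m - i\<close> of the independence
            lemma.\<close>
          have expand: "S_sum q (2 * m + 1) n * qint q 2 / ?v
            = (\<Sum>i\<le>m. (- (q ^ n)) ^ i * (c q i * eval_int_poly q (X i)) * ?v ^ (m - i))"
            if "GZ_P_prop m X" for X
          proof -
            have "S_sum q (2 * m + 1) n = (\<Sum>i\<le>m. (- (q ^ n)) ^ i * (c q i * eval_int_poly q (X i))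
              * ?v ^ (m - i)) * ?v / qint q 2"
              using that n q sum_complement_index[of "\<lambda>i k. (- (q ^ n)) ^ i * (qfact q k / qfact q (m + 1))
              * eval_int_poly q (X i) * ?v ^ (k + 1) / qint q 2" m]
              unfolding GZ_P_prop_def c_def
              by (simp add: sum_divide_distrib sum_distrib_left sum_distrib_right mult_ac)
            then show ?thesis using v qint_pos[OF q, of 2] by simp
          qed
          have "(\<Sum>i\<le>m. (- (q ^ n)) ^ i * (c q i * eval_int_poly q (P i) - c q i * eval_int_poly q (R i))
              * ?v ^ (m - i)) = S_sum q (2 * m + 1) n * qint q 2 / ?v - S_sum q (2 * m + 1) n * qint q 2 / ?v"
            by (subst expand[OF P], subst expand[OF R])
               (simp add: left_diff_distrib right_diff_distrib sum_subtractf)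
          then show "(\<Sum>i\<le>m. (- (q ^ n)) ^ i
              * (c q i * eval_int_poly q (P i) - c q i * eval_int_poly q (R i)) * ?v ^ (m - i)) = 0"
            by simp
        qed
        then show "eval_int_poly q (P i) = eval_int_poly q (R i)"
          using c_pos[OF q True] by simp
      qed
    qed (use P in \<open>simp add: GZ_P_prop_def R_def\<close>)
  qed
  with R have "GZ_P m = R"
    unfolding GZ_P_def by (intro the_equality)
  then show ?thesis using assms by (simp add: R_def)
qed

lemma GZ_Q_eq:
  assumes "1 \<le> m" "k \<le> m"
  shows "GZ_Q m k = chain_sum [:0, 0, 1:] [:0, 1, 1:] k (m - k) (m - k) (m - k)"
proof -
  define R where "R j = (if j \<le> m then chain_sum [:0, 0, 1:] [:0, 1, 1:] j (m - j) (m - j) (m - j) else 0 :: int poly)"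
    for j :: nat
  define c where "c q i = (1 - sqrt q) ^ i / (\<Prod>t = 0..i. 1 - q ^ (m - t) * sqrt q)" for q i
  have sqrt_bound: "0 < sqrt q" "sqrt q < 1" if "0 < q" "q < 1" for q :: real
    using that by auto
  have factor_pos: "0 < 1 - q ^ l * sqrt q" if "0 < q" "q < 1" for q l
  proof -
    have "q ^ l * sqrt q \<le> sqrt q"
      using that by (intro mult_left_le_one_le) (auto simp: power_le_one)
    then show ?thesis using sqrt_bound[OF that] by linarith
  qed
  have c_pos: "c q i > 0" if "0 < q" "q < 1" for q i
    unfolding c_def using sqrt_bound[OF that] by (intro divide_pos_pos prod_pos factor_pos that) auto
  have R: "GZ_Q_prop m R"
    unfolding GZ_Q_prop_def
  proof (intro conjI allI impI)
    fix n :: nat and q :: real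
    assume "1 \<le> n" and q: "0 < q \<and> q < 1"
    define p where "p = sqrt q"
    have p: "0 < p" "p < 1" "q = p\<^sup>2" using q by (auto simp: p_def)
    have nz: "single_path_sum q (q + p) 0 r \<noteq> 0" for r
      using qint_pos[of p "Suc (2 * r)"] p by (simp only: p(3), subst single_path_sum_odd_qint) auto
    have path: "single_path_sum q (q + p) 0 r = (1 - q ^ r * sqrt q) / (1 - p)" for r
    proof -
      have "p ^ Suc (2 * r) = q ^ r * sqrt q" using p by (simp add: power_mult)
      then show ?thesis
        using single_path_sum_odd_qint[of p r] p(2) by (simp only: p(3) qint_def)
    qed
    \<comment> \<open>The denominator has \<open>i + 1\<close> factors \<open>1 / (1 - p)\<close>
      but \<open>c\<close> contains only \<open>(1 - p)^i\<close>; the spare factor cancels the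
      division by \<open>1 - p\<close> in the even formula.\<close>
    have "faulhaber_coeff q (q + p) m i = (1 - p) * (c q i * eval_int_poly p (R i))"
      if "i \<le> m" for i
    proof -
      have "(\<Prod>t\<le>i. single_path_sum q (q + p) 0 (m - t))
          = (\<Prod>t\<le>i. (1 - q ^ (m - t) * sqrt q) / (1 - p))"
        by (simp only: path)
      also have "\<dots> = (\<Prod>t = 0..i. 1 - q ^ (m - t) * sqrt q) / (1 - p) ^ Suc i"
        by (simp add: prod_dividef atMost_atLeast0)
      finally have prod: "(\<Prod>t\<le>i. single_path_sum q (q + p) 0 (m - t))
          = (\<Prod>t = 0..i. 1 - q ^ (m - t) * sqrt q) / (1 - p) ^ Suc i" .
      have "eval_int_poly p (R i) = chain_sum q (q + p) i (m - i) (m - i) (m - i)"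
        using that p(3)
        by (simp add: R_def eval_int_poly_chain_sum map_poly_pCons power2_eq_square algebra_simps
            del: chain_sum.simps)
      then show ?thesis
        unfolding faulhaber_coeff_def[OF nz] prod c_def by (simp add: p_def)
    qed
    then have "S_sum q (2 * m) n = (1 - q ^ n * p) *
      (\<Sum>i\<le>m. (- (q ^ n)) ^ i * ((1 - p) * (c q i * eval_int_poly p (R i)))
       * (qint q n * qint q (n + 1)) ^ (m - i)) / (1 - p) / qint q 2"
      using S_sum_even[of p m n] p assms(1) by simp
    also have "\<dots> = (1 - q ^ n * p) *
      (\<Sum>i\<le>m. (- (q ^ n)) ^ i * (c q i * eval_int_poly p (R i))
       * (qint q n * qint q (n + 1)) ^ (m - i) / qint q 2)"
    proof -
      have "(\<Sum>i\<le>m. (- (q ^ n)) ^ i * ((1 - p) * (c q i * eval_int_poly p (R i)))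
         * (qint q n * qint q (n + 1)) ^ (m - i))
        = (1 - p) * (\<Sum>i\<le>m. (- (q ^ n)) ^ i * (c q i * eval_int_poly p (R i))
         * (qint q n * qint q (n + 1)) ^ (m - i))"
        unfolding sum_distrib_left by (intro sum.cong refl) (simp only: mult_ac)
      then show ?thesis using p by (simp flip: sum_divide_distrib)
    qed
    finally show "S_sum q (2 * m) n = (1 - q ^ n * sqrt q) *
          (\<Sum>k = 0..m. (- (q ^ n)) ^ (m - k)
              * ((1 - sqrt q) ^ (m - k) * eval_int_poly (sqrt q) (R (m - k))
                 / (\<Prod>i = 0..m - k. 1 - q ^ (m - i) * sqrt q))
              * (qint q n * qint q (n + 1)) ^ k / qint q 2)"
      using sum_complement_index[of "\<lambda>i k. (- (q ^ n)) ^ i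
              * ((1 - sqrt q) ^ i * eval_int_poly (sqrt q) (R i)
                 / (\<Prod>i = 0..i. 1 - q ^ (m - i) * sqrt q))
              * (qint q n * qint q (n + 1)) ^ k / qint q 2" m]
      by (simp add: c_def p_def)
  qed (simp add: R_def)
  have "Q = R" if Q: "GZ_Q_prop m Q" for Q
  proof
    fix i
    show "Q i = R i"
    proof (cases "i \<le> m")
      case True
      show ?thesis
      proof (rule int_poly_eq_if_eval_eq)
        \<comment> \<open>The polynomials are evaluated at the square root of \<open>q\<close>, so
          the comparison starts from an arbitrary \<open>p\<close> in (0,1) and sets
          \<open>q = p^2\<close>.\<close>
        fix p :: real assume p: "0 < p" "p < 1"
        define q where "q = p\<^sup>2"
        have q: "0 < q" "q < 1" "sqrt q = p"
          using p by (auto simp: q_def power_less_one_iff)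
        have "c q i * eval_int_poly p (Q i) - c q i * eval_int_poly p (R i) = 0"
        proof (rule faulhaber_basis_independent[OF q(1,2) _ True])
          fix n :: nat assume n: "1 \<le> n"
          let ?v = "qint q n * qint q (n + 1)"
          have expand: "S_sum q (2 * m) n * qint q 2 / (1 - q ^ n * p)
            = (\<Sum>i\<le>m. (- (q ^ n)) ^ i * (c q i * eval_int_poly p (X i)) * ?v ^ (m - i))"
            if "GZ_Q_prop m X" for X
          proof -
            have "S_sum q (2 * m) n = (1 - q ^ n * p) *
              (\<Sum>i\<le>m. (- (q ^ n)) ^ i * (c q i * eval_int_poly p (X i)) * ?v ^ (m - i) / qint q 2)"
              using that n q sum_complement_index[of "\<lambda>i k. (- (q ^ n)) ^ i
              * ((1 - sqrt q) ^ i * eval_int_poly (sqrt q) (X i)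
                 / (\<Prod>i = 0..i. 1 - q ^ (m - i) * sqrt q)) * ?v ^ k / qint q 2" m]
              unfolding GZ_Q_prop_def c_def by simp
            then have "S_sum q (2 * m) n = (1 - q ^ n * p) *
              (\<Sum>i\<le>m. (- (q ^ n)) ^ i * (c q i * eval_int_poly p (X i)) * ?v ^ (m - i)) / qint q 2"
              by (simp only: times_divide_eq_right flip: sum_divide_distrib)
            then show ?thesis
              using factor_pos[OF q(1,2), of n] qint_pos[OF q(1,2), of 2] q(3) by simp
          qed
          have "(\<Sum>i\<le>m. (- (q ^ n)) ^ i * (c q i * eval_int_poly p (Q i) - c q i * eval_int_poly p (R i))
              * ?v ^ (m - i)) = S_sum q (2 * m) n * qint q 2 / (1 - q ^ n * p)
                - S_sum q (2 * m) n * qint q 2 / (1 - q ^ n * p)"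
            by (subst expand[OF Q], subst expand[OF R])
               (simp add: left_diff_distrib right_diff_distrib sum_subtractf)
          then show "(\<Sum>i\<le>m. (- (q ^ n)) ^ i
              * (c q i * eval_int_poly p (Q i) - c q i * eval_int_poly p (R i)) * ?v ^ (m - i)) = 0"
            by simp
        qed
        then show "eval_int_poly p (Q i) = eval_int_poly p (R i)"
          using c_pos[OF q(1,2), of i] by simp
      qed
    qed (use Q in \<open>simp add: GZ_Q_prop_def R_def\<close>)
  qed
  with R have "GZ_Q m = R"
    unfolding GZ_Q_def by (intro the_equality)
  then show ?thesis using assms by (simp add: R_def)
qed

section \<open>Lattice paths as height triples\<close>

definition column_seg :: "int \<Rightarrow> int \<Rightarrow> int \<Rightarrow> (int \<times> int) list" where
  "column_seg x s t = map (Pair x) [s..t]"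

lemma column_seg_Cons: "s \<le> t \<Longrightarrow> column_seg x s t = (x, s) # column_seg x (s + 1) t"
  by (simp add: column_seg_def upto_rec1)

lemma column_seg_Nil: "t < s \<Longrightarrow> column_seg x s t = []"
  by (simp add: column_seg_def)

definition lattice_step :: "int \<times> int \<Rightarrow> int \<times> int \<Rightarrow> bool" where
  "lattice_step u v \<longleftrightarrow> fst v = fst u + 1 \<and> snd v = snd u \<or> fst v = fst u \<and> snd v = snd u + 1"

lemma lattice_path_altdef:
  "lattice_path L a b \<longleftrightarrow> L \<noteq> [] \<and> hd L = a \<and> last L = b \<and> successively lattice_step L"
  by (simp add: lattice_path_def successively_conv_nth lattice_step_def)

lemma lattice_path_Cons:
  "lattice_path (p # L) a b \<longleftrightarrow> p = a \<and> (if L = [] then a = b else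
     lattice_path L (fst a + 1, snd a) b \<or> lattice_path L (fst a, snd a + 1) b)"
proof (cases L)
  case Nil
  then show ?thesis by (auto simp: lattice_path_altdef)
next
  case (Cons p' L')
  have "lattice_step p p' \<longleftrightarrow> p' = (fst p + 1, snd p) \<or> p' = (fst p, snd p + 1)"
    by (auto simp: lattice_step_def prod_eq_iff)
  then show ?thesis using Cons by (auto simp: lattice_path_altdef)
qed

lemma lattice_path_bounds: "lattice_path L a b \<Longrightarrow> fst a \<le> fst b \<and> snd a \<le> snd b"
proof (induction L arbitrary: a)
  case Nil
  then show ?case by (simp add: lattice_path_def)
next
  case (Cons p L)
  then show ?case by (fastforce simp: lattice_path_Cons split: if_splits)
qed

lemma lattice_path_vertical:
  "lattice_path L (x, s) (x, t) \<longleftrightarrow> s \<le> t \<and> L = column_seg x s t"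
proof (induction L arbitrary: s)
  case Nil
  then show ?case by (auto simp: lattice_path_def column_seg_Cons)
next
  case (Cons p L)
  have "\<not> lattice_path L (x + 1, s) (x, t)" using lattice_path_bounds by fastforce
  then show ?case
    by (cases "s = t") (auto simp: lattice_path_Cons Cons.IH column_seg_Cons column_seg_Nil)
qed

text \<open>Cut the path where it leaves its first column, at height \<open>a\<close>. Applying this
  three times reduces a path of width 3 to a vertical one.\<close>

lemma lattice_path_first_column:
  assumes "x < x'"
  shows "lattice_path L (x, s) (x', t) \<longleftrightarrow>
     (\<exists>a L'. s \<le> a \<and> L = column_seg x s a @ L' \<and> lattice_path L' (x + 1, a) (x', t))"
proof (induction L arbitrary: s)
  case Nil
  then show ?case by (auto simp: lattice_path_def)
next
  case (Cons p L)
  show ?case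
  proof
    assume "lattice_path (p # L) (x, s) (x', t)"
    then consider "p = (x, s)" "lattice_path L (x + 1, s) (x', t)"
      | "p = (x, s)" "lattice_path L (x, s + 1) (x', t)"
      using assms by (auto simp: lattice_path_Cons split: if_splits)
    then show "\<exists>a L'. s \<le> a \<and> p # L = column_seg x s a @ L' \<and> lattice_path L' (x + 1, a) (x', t)"
    proof cases
      case 1
      then show ?thesis
        by (intro exI[of _ s] exI[of _ L]) (simp add: column_seg_Cons column_seg_Nil)
    next
      case 2
      then obtain a L' where "s + 1 \<le> a" "L = column_seg x (s + 1) a @ L'"
        "lattice_path L' (x + 1, a) (x', t)"
        using Cons.IH by auto
      then show ?thesis
        using 2 by (intro exI[of _ a] exI[of _ L']) (simp add: column_seg_Cons)
    qed
  next
    assume "\<exists>a L'. s \<le> a \<and> p # L = column_seg x s a @ L' \<and> lattice_path L' (x + 1, a) (x', t)"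
    then obtain a L' where L': "s \<le> a" "p = (x, s)" "L = column_seg x (s + 1) a @ L'"
        "lattice_path L' (x + 1, a) (x', t)"
      by (auto simp: column_seg_Cons)
    then have "L \<noteq> []" by (auto simp: lattice_path_def)
    show "lattice_path (p # L) (x, s) (x', t)"
    proof (cases "a = s")
      case True
      then show ?thesis
        using L' \<open>L \<noteq> []\<close> by (simp add: lattice_path_Cons column_seg_Nil)
    next
      case False
      then have "lattice_path L (x, s + 1) (x', t)"
        using L' by (subst Cons.IH) (intro exI[of _ a] exI[of _ L'], simp)
      then show ?thesis
        using L'(2) \<open>L \<noteq> []\<close> by (simp add: lattice_path_Cons)
    qed
  qed
qed

definition three_step_path :: "int \<Rightarrow> int \<Rightarrow> int \<Rightarrow> int \<Rightarrow> int \<Rightarrow> int \<Rightarrow> (int \<times> int) list" where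
  "three_step_path x s a b c t =
     column_seg x s a @ column_seg (x + 1) a b @ column_seg (x + 2) b c @ column_seg (x + 3) c t"

lemma lattice_path_three_step:
  "lattice_path L (x, s) (x + 3, t) \<longleftrightarrow>
     (\<exists>a b c. s \<le> a \<and> a \<le> b \<and> b \<le> c \<and> c \<le> t \<and> L = three_step_path x s a b c t)"
proof -
  have 1: "lattice_path L (x, s) (x + 3, t) \<longleftrightarrow>
      (\<exists>a L'. s \<le> a \<and> L = column_seg x s a @ L' \<and> lattice_path L' (x + 1, a) (x + 3, t))"
    by (rule lattice_path_first_column) simp
  have 2: "lattice_path L (x + 1, a) (x + 3, t) \<longleftrightarrow>
      (\<exists>b L'. a \<le> b \<and> L = column_seg (x + 1) a b @ L' \<and> lattice_path L' (x + 2, b) (x + 3, t))"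
    for L a using lattice_path_first_column[of "x + 1" "x + 3" L a t] by (simp add: add.commute)
  have 3: "lattice_path L (x + 2, b) (x + 3, t) \<longleftrightarrow>
      (\<exists>c L'. b \<le> c \<and> L = column_seg (x + 2) b c @ L' \<and> lattice_path L' (x + 3, c) (x + 3, t))"
    for L b using lattice_path_first_column[of "x + 2" "x + 3" L b t] by (simp add: add.commute)
  show ?thesis
    unfolding 1 2 3 lattice_path_vertical three_step_path_def by blast
qed

section \<open>Weights and point sets of paths with three horizontal steps\<close>

lemma path_weight_Cons:
  "L \<noteq> [] \<Longrightarrow> path_weight w (p # L) = w p (hd L) * path_weight w L"
proof (cases L)
  case (Cons p' L')
  have "map (\<lambda>i. w ((p # L) ! i) ((p # L) ! Suc i)) [0..<length L]
      = w p p' # map (\<lambda>i. w (L ! i) (L ! Suc i)) [0..<length L - 1]"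
    using Cons by (simp add: map_upt_Suc del: upt_Suc)
  then show ?thesis using Cons by (simp add: path_weight_def)
qed simp

lemma path_weight_column_seg:
  assumes "s \<le> a" "L \<noteq> []" "hd L = (x + 1, a)"
    and "w (x, a) (x + 1, a) = 1"
  shows "path_weight w (column_seg x s a @ L)
     = (\<Prod>i<nat (a - s). w (x, s + int i) (x, s + int i + 1)) * path_weight w L"
  using assms(1)
proof (induction "nat (a - s)" arbitrary: s)
  case 0
  then show ?case
    using assms by (simp add: column_seg_Cons column_seg_Nil path_weight_Cons)
next
  case (Suc n)
  then have n: "n = nat (a - (s + 1))" and s: "s < a" by auto
  have "nat (a - s) = Suc n" using Suc.hyps(2) by simp
  moreover have "path_weight w (column_seg x s a @ L)
    = w (x, s) (x, s + 1) * path_weight w (column_seg x (s + 1) a @ L)"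
    using s by (simp add: column_seg_Cons path_weight_Cons)
  ultimately show ?case
    using Suc.hyps(1)[OF n] s n
    by (simp add: prod.lessThan_Suc_shift add.commute add.left_commute mult.assoc
        del: prod.lessThan_Suc)
qed

lemma path_weight_column_seg_last:
  assumes "s \<le> a"
  shows "path_weight w (column_seg x s a)
     = (\<Prod>i<nat (a - s). w (x, s + int i) (x, s + int i + 1))"
  using assms
proof (induction "nat (a - s)" arbitrary: s)
  case 0
  then show ?case by (simp add: column_seg_Cons column_seg_Nil path_weight_def)
next
  case (Suc n)
  then have n: "n = nat (a - (s + 1))" and s: "s < a" by auto
  have "nat (a - s) = Suc n" using Suc.hyps(2) by simp
  moreover have "path_weight w (column_seg x s a)
    = w (x, s) (x, s + 1) * path_weight w (column_seg x (s + 1) a)"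
    using s by (simp add: column_seg_Cons path_weight_Cons)
  ultimately show ?case
    using Suc.hyps(1)[OF n] s n
    by (simp add: prod.lessThan_Suc_shift add.commute add.left_commute mult.assoc
        del: prod.lessThan_Suc)
qed

lemma column_seg_hd: "s \<le> a \<Longrightarrow> hd (column_seg x s a) = (x, s)" "s \<le> a \<Longrightarrow> column_seg x s a \<noteq> []"
  by (simp_all add: column_seg_Cons)

lemma path_weight_three_step:
  assumes "s \<le> a" "a \<le> b" "b \<le> c" "c \<le> t"
    and "\<And>x y. w (x, y) (x + 1, y) = 1" "\<And>x y. odd x \<Longrightarrow> w (x, y) (x, y + 1) = 1" "even x"
  shows "path_weight w (three_step_path x s a b c t)
     = (\<Prod>i<nat (a - s). w (x, s + int i) (x, s + int i + 1))
       * (\<Prod>i<nat (c - b). w (x + 2, b + int i) (x + 2, b + int i + 1))"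
proof -
  have [simp]: "x + 1 + 1 = x + 2" "x + 2 + 1 = x + 3" by simp_all
  have [simp]: "w (x + 1, y) (x + 2, y) = 1" "w (x + 2, y) (x + 3, y) = 1" for y
    using assms(5)[of "x + 1" y] assms(5)[of "x + 2" y] by simp_all
  show ?thesis
    using assms unfolding three_step_path_def
    by (simp add: path_weight_column_seg path_weight_column_seg_last column_seg_hd)
qed

lemma set_three_step_path:
  "set (three_step_path x s a b c t)
     = {x} \<times> {s..a} \<union> {x + 1} \<times> {a..b} \<union> {x + 2} \<times> {b..c} \<union> {x + 3} \<times> {c..t}"
  by (auto simp: three_step_path_def column_seg_def)

text \<open>The point set shows in each column a nonempty interval, whose upper end is the height at
  which the path leaves the column.\<close>

lemma three_step_path_inject:
  assumes eq: "three_step_path x s a b c t = three_step_path x s a' b' c' t"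
    and "s \<le> a" "a \<le> b" "b \<le> c" "s \<le> a'" "a' \<le> b'" "b' \<le> c'"
  shows "a = a' \<and> b = b' \<and> c = c'"
proof -
  let ?S = "set (three_step_path x s a b c t)" and ?S' = "set (three_step_path x s a' b' c' t)"
  have "{y. (x, y) \<in> ?S} = {s..a}" "{y. (x + 1, y) \<in> ?S} = {a..b}" "{y. (x + 2, y) \<in> ?S} = {b..c}"
    "{y. (x, y) \<in> ?S'} = {s..a'}" "{y. (x + 1, y) \<in> ?S'} = {a'..b'}" "{y. (x + 2, y) \<in> ?S'} = {b'..c'}"
    by (auto simp: set_three_step_path)
  then show ?thesis
    using assms by (metis Icc_eq_Icc order_trans)
qed

section \<open>Chains of compatible height triples and non-intersecting families\<close>

definition heights_below :: "nat \<Rightarrow> nat \<times> nat \<times> nat \<Rightarrow> bool" where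
  "heights_below M = (\<lambda>(x, y, z). x \<le> y \<and> y \<le> z \<and> z < M)"

definition compatible_heights :: "nat \<times> nat \<times> nat \<Rightarrow> nat \<times> nat \<times> nat \<Rightarrow> bool" where
  "compatible_heights = (\<lambda>(x, y, z) (x', y', z'). x' \<le> Suc y \<and> y' \<le> Suc z)"

primrec chains :: "nat \<Rightarrow> nat \<Rightarrow> nat \<Rightarrow> nat \<Rightarrow> (nat \<times> nat \<times> nat) list set" where
  "chains 0 M b c = {[]}"
| "chains (Suc n) M b c = (\<Union>(x, y, z) \<in> {(x, y, z). heights_below M (x, y, z) \<and> x \<le> b \<and> y \<le> c}.
     Cons (x, y, z) ` chains n (Suc M) (Suc y) (Suc z))"

lemma finite_heights_below: "finite {(x, y, z). heights_below M (x, y, z) \<and> x \<le> b \<and> y \<le> c}"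
  by (rule finite_subset[of _ "{..M} \<times> {..M} \<times> {..M}"]) (auto simp: heights_below_def)

lemma finite_chains: "finite (chains n M b c)"
proof (induction n arbitrary: M b c)
  case (Suc n)
  then show ?case unfolding chains.simps
    by (intro finite_UN_I[OF finite_heights_below]) auto
qed simp

lemma sum_chains:
  "(\<Sum>ds\<in>chains n M b c. \<Prod>(x, y, z)\<leftarrow>ds. column_weight q \<kappa> x * q ^ (z - y))
   = chain_sum q \<kappa> n M b c"
proof (induction n arbitrary: M b c)
  case (Suc n)
  let ?w = "\<lambda>(x, y, z). column_weight q \<kappa> x * q ^ (z - y)"
  let ?B = "{(x, y, z). heights_below M (x, y, z) \<and> x \<le> b \<and> y \<le> c}"
  have "(\<Sum>ds\<in>chains (Suc n) M b c. prod_list (map ?w ds))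
      = (\<Sum>d\<in>?B. \<Sum>ds\<in>(\<lambda>(x, y, z). Cons (x, y, z) ` chains n (Suc M) (Suc y) (Suc z)) d.
           prod_list (map ?w ds))"
    unfolding chains.simps
    by (rule sum.UNION_disjoint) (auto simp: finite_heights_below finite_chains)
  also have "\<dots> = (\<Sum>(x, y, z)\<in>?B. column_weight q \<kappa> x * q ^ (z - y) * chain_sum q \<kappa> n (Suc M) (Suc y) (Suc z))"
    by (intro sum.cong) (auto simp: sum.reindex sum_distrib_left[symmetric] Suc.IH)
  \<comment> \<open>Triples are reversed to follow the nesting of the sums in
    \<open>chain_sum\<close>, and the two bounds move from the index set into the summand.\<close>
  also have "\<dots> = (\<Sum>(z, y, x)\<in>(SIGMA z:{..<M}. SIGMA y:{..z}. {..y}).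
      if x \<le> b \<and> y \<le> c then column_weight q \<kappa> x * q ^ (z - y) * chain_sum q \<kappa> n (Suc M) (Suc y) (Suc z) else 0)"
  proof (rule sum.reindex_bij_witness_not_neutral[of "{}"
        "{(z, y, x). \<not> (x \<le> b \<and> y \<le> c)} \<inter> (SIGMA z:{..<M}. SIGMA y:{..z}. {..y})" _
        "\<lambda>(z, y, x). (x, y, z)" "\<lambda>(x, y, z). (z, y, x)"])
  qed (auto simp: heights_below_def intro: finite_subset)
  also have "\<dots> = chain_sum q \<kappa> (Suc n) M b c"
    by (simp add: sum.Sigma)
  finally show ?case .
qed simp

lemma mem_chains_iff:
  "ds \<in> chains n M b c \<longleftrightarrow> length ds = n \<and> (\<forall>i<n. heights_below (M + i) (ds ! i))
     \<and> (0 < n \<longrightarrow> fst (ds ! 0) \<le> b \<and> fst (snd (ds ! 0)) \<le> c)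
     \<and> (\<forall>i. Suc i < n \<longrightarrow> compatible_heights (ds ! i) (ds ! Suc i))"
proof (induction n arbitrary: ds M b c)
  case (Suc n)
  show ?case
  proof (cases ds)
    case (Cons d ds')
    obtain x y z where d: "d = (x, y, z)" by (cases d)
    have "ds \<in> chains (Suc n) M b c \<longleftrightarrow>
        heights_below M d \<and> x \<le> b \<and> y \<le> c \<and> ds' \<in> chains n (Suc M) (Suc y) (Suc z)"
      by (auto simp: Cons d)
    moreover have "compatible_heights d d' \<longleftrightarrow> fst d' \<le> Suc y \<and> fst (snd d') \<le> Suc z" for d'
      by (auto simp: compatible_heights_def d split: prod.splits)
    moreover have "(\<forall>i<Suc n. heights_below (M + i) (ds ! i)) \<longleftrightarrow>
        heights_below M d \<and> (\<forall>i<n. heights_below (Suc M + i) (ds' ! i))"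
      by (auto simp: Cons less_Suc_eq_0_disj)
    moreover have "(\<forall>i. Suc i < Suc n \<longrightarrow> compatible_heights (ds ! i) (ds ! Suc i)) \<longleftrightarrow>
        (0 < n \<longrightarrow> compatible_heights d (ds' ! 0)) \<and>
        (\<forall>i. Suc i < n \<longrightarrow> compatible_heights (ds' ! i) (ds' ! Suc i))"
    proof -
      have "(\<forall>i<n. P i) \<longleftrightarrow> (0 < n \<longrightarrow> P 0) \<and> (\<forall>i. Suc i < n \<longrightarrow> P (Suc i))" for P
        by (metis gr0_conv_Suc not_gr0)
      then show ?thesis by (simp add: Cons)
    qed
    ultimately show ?thesis using Suc.IH[of ds' "Suc M" "Suc y" "Suc z"] d Cons by auto
  qed auto
qed auto

text \<open>\<open>K\<close> stands for \<open>m - k\<close>. Heights are measured from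
  \<open>u_i\<close>, so \<open>2 i\<close> is subtracted, and the end height
  \<open>K - i - 1\<close> becomes the condition \<open>z < K + i\<close>.\<close>

definition path_of_heights :: "nat \<Rightarrow> nat \<Rightarrow> nat \<times> nat \<times> nat \<Rightarrow> (int \<times> int) list" where
  "path_of_heights K i = (\<lambda>(x, y, z). three_step_path (2 * int i) (- 2 * int i)
     (int x - 2 * int i) (int y - 2 * int i) (int z - 2 * int i) (int K - int i - 1))"

lemma lattice_path_iff_heights:
  "lattice_path L (pt_u i) (2 * int i + 3, int K - int i - 1)
   \<longleftrightarrow> (\<exists>d. heights_below (K + i) d \<and> L = path_of_heights K i d)"
proof
  assume "lattice_path L (pt_u i) (2 * int i + 3, int K - int i - 1)"
  then obtain a b c where abc: "- 2 * int i \<le> a" "a \<le> b" "b \<le> c" "c \<le> int K - int i - 1"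
    "L = three_step_path (2 * int i) (- 2 * int i) a b c (int K - int i - 1)"
    by (auto simp: pt_u_def lattice_path_three_step)
  then show "\<exists>d. heights_below (K + i) d \<and> L = path_of_heights K i d"
    by (intro exI[of _ "(nat (a + 2 * int i), nat (b + 2 * int i), nat (c + 2 * int i))"])
       (auto simp: heights_below_def path_of_heights_def)
next
  assume "\<exists>d. heights_below (K + i) d \<and> L = path_of_heights K i d"
  then obtain x y z where "heights_below (K + i) (x, y, z)" "L = path_of_heights K i (x, y, z)"
    by (metis prod_cases3)
  then show "lattice_path L (pt_u i) (2 * int i + 3, int K - int i - 1)"
    unfolding pt_u_def lattice_path_three_step
    by (intro exI[of _ "int x - 2 * int i"] exI[of _ "int y - 2 * int i"] exI[of _ "int z - 2 * int i"])
       (auto simp: heights_below_def path_of_heights_def)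
qed

lemma path_of_heights_inject:
  assumes "heights_below (K + i) d" "heights_below (K + i) d'"
    and "path_of_heights K i d = path_of_heights K i d'"
  shows "d = d'"
proof -
  obtain x y z x' y' z' where [simp]: "d = (x, y, z)" "d' = (x', y', z')"
    by (cases d, cases d')
  show ?thesis
    using assms three_step_path_inject[of "2 * int i" "- 2 * int i"
        "int x - 2 * int i" "int y - 2 * int i" "int z - 2 * int i" "int K - int i - 1"
        "int x' - 2 * int i" "int y' - 2 * int i" "int z' - 2 * int i"]
    by (auto simp: heights_below_def path_of_heights_def)
qed

text \<open>Path \<open>i\<close> occupies columns \<open>2i\<close> to \<open>2i + 3\<close>, so
  only neighbours share columns, namely two. In each of these the later path has to end below the
  point where the earlier one enters.\<close>

lemma disjoint_paths_iff:
  assumes "heights_below (K + i) d" "heights_below (K + j) d'" "i < j"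
  shows "set (path_of_heights K i d) \<inter> set (path_of_heights K j d') = {}
    \<longleftrightarrow> (j = Suc i \<longrightarrow> compatible_heights d d')"
proof -
  obtain x y z x' y' z' where d: "d = (x, y, z)" "d' = (x', y', z')"
    by (cases d, cases d')
  show ?thesis
  proof (cases "j = Suc i")
    case False
    then have "2 * int i + 4 \<le> 2 * int j" using assms(3) by simp
    then show ?thesis using False
      by (auto simp: d path_of_heights_def set_three_step_path)
  next
    case True
    have b: "x \<le> y" "y \<le> z" "x' \<le> y'" "y' \<le> z'" "z' \<le> K + i"
      using assms True by (auto simp: d heights_below_def)
    show ?thesis
    proof (cases "compatible_heights d d'")
      case True
      then show ?thesis using b \<open>j = Suc i\<close>
        by (auto simp: d path_of_heights_def set_three_step_path compatible_heights_def)
    next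
      case False
      then have "\<not> (x' \<le> Suc y \<and> y' \<le> Suc z)"
        by (simp add: d compatible_heights_def)
      then consider "Suc y < x'" | "x' \<le> Suc y" "Suc z < y'"
        by linarith
      then have "set (path_of_heights K i d) \<inter> set (path_of_heights K j d') \<noteq> {}"
      proof cases
        case 1
        \<comment> \<open>The common point is where path \<open>i\<close> enters the shared column;
          in the second case it is the entry into the next column.\<close>
        then have "(2 * int i + 2, int y - 2 * int i)
            \<in> set (path_of_heights K i d) \<inter> set (path_of_heights K j d')"
          using b \<open>j = Suc i\<close> by (auto simp: d path_of_heights_def set_three_step_path)
        then show ?thesis by blast
      next
        case 2
        then have "(2 * int i + 3, int z - 2 * int i)
            \<in> set (path_of_heights K i d) \<inter> set (path_of_heights K j d')"
          using b \<open>j = Suc i\<close> assms(1)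
          by (auto simp: d path_of_heights_def set_three_step_path heights_below_def)
        then show ?thesis by blast
      qed
      then show ?thesis using False \<open>j = Suc i\<close> by simp
    qed
  qed
qed

lemma bij_betw_chains_path_families:
  assumes "k \<le> m"
  shows "bij_betw (\<lambda>ds i. if i < k then path_of_heights (m - k) i (ds ! i) else [])
    (chains k (m - k) (m - k) (m - k)) (path_families m k)"
proof (rule bij_betw_imageI)
  let ?K = "m - k"
  let ?F = "\<lambda>ds i. if i < k then path_of_heights ?K i (ds ! i) else []"
  have v: "pt_v m k i = (2 * int i + 3, int ?K - int i - 1)" for i
    using assms by (simp add: pt_v_def)
  show "inj_on ?F (chains k ?K ?K ?K)"
  proof (rule inj_onI)
    fix ds ds' assume ds: "ds \<in> chains k ?K ?K ?K" "ds' \<in> chains k ?K ?K ?K" and eq: "?F ds = ?F ds'"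
    show "ds = ds'"
    proof (rule nth_equalityI)
      show "length ds = length ds'" using ds by (simp add: mem_chains_iff)
      fix i assume "i < length ds"
      then have "i < k" using ds by (simp add: mem_chains_iff)
      then show "ds ! i = ds' ! i"
        using ds fun_cong[OF eq, of i]
        by (intro path_of_heights_inject[of ?K i]) (auto simp: mem_chains_iff)
    qed
  qed
  show "?F ` chains k ?K ?K ?K = path_families m k"
  proof (intro equalityI subsetI)
    fix L assume "L \<in> ?F ` chains k ?K ?K ?K"
    then obtain ds where ds: "ds \<in> chains k ?K ?K ?K" and L: "L = ?F ds" by blast
    have below: "heights_below (?K + i) (ds ! i)" if "i < k" for i
      using ds that by (simp add: mem_chains_iff)
    have disj: "set (L i) \<inter> set (L j) = {}" if "i < j" "j < k" for i j
      using that ds disjoint_paths_iff[OF below[of i] below[of j]]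
      by (auto simp: L mem_chains_iff)
    have "set (L i) \<inter> set (L j) = {}" if "i < k" "j < k" "i \<noteq> j" for i j
      using that disj[of i j] disj[of j i] by (cases i j rule: linorder_cases) auto
    moreover have "lattice_path (L i) (pt_u i) (pt_v m k i)" if "i < k" for i
      unfolding v lattice_path_iff_heights using below[OF that] that by (intro exI[of _ "ds ! i"]) (simp add: L)
    ultimately show "L \<in> path_families m k"
      by (simp add: path_families_def L)
  next
    fix L assume L: "L \<in> path_families m k"
    then have "\<forall>i\<in>{..<k}. \<exists>d. heights_below (?K + i) d \<and> L i = path_of_heights ?K i d"
      by (simp add: path_families_def v lattice_path_iff_heights)
    then obtain g where g: "heights_below (?K + i) (g i)" "L i = path_of_heights ?K i (g i)"
      if "i < k" for i
      by (metis lessThan_iff)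
    have "compatible_heights (g i) (g (Suc i))" if "Suc i < k" for i
    proof -
      have "set (L i) \<inter> set (L (Suc i)) = {}"
        using L that by (simp add: path_families_def)
      then show ?thesis
        using disjoint_paths_iff[of ?K i "g i" "Suc i" "g (Suc i)"] g[of i] g[of "Suc i"] that by simp
    qed
    \<comment> \<open>The bounds on the first triple hold automatically, as its heights are below
      \<open>?K\<close>.\<close>
    then have "map g [0..<k] \<in> chains k ?K ?K ?K"
      using g(1) g(1)[of 0] by (auto simp: mem_chains_iff heights_below_def)
    moreover have "L = ?F (map g [0..<k])"
      using L g(2) by (auto simp: path_families_def)
    ultimately show "L \<in> ?F ` chains k ?K ?K ?K" by blast
  qed
qed

section \<open>Path sums as chain sums\<close>

lemma path_weight_path_of_heights:
  assumes "heights_below (K + i) (x, y, z)"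
    and "\<And>x y. w (x, y) (x + 1, y) = 1" "\<And>x y. odd x \<Longrightarrow> w (x, y) (x, y + 1) = 1"
    and start: "w (pt_u i) (2 * int i, - 2 * int i + 1) = \<kappa>"
    and above: "\<And>j y. - 2 * int j < y \<Longrightarrow> w (2 * int j, y) (2 * int j, y + 1) = q"
  shows "path_weight w (path_of_heights K i (x, y, z)) = column_weight q \<kappa> x * q ^ (z - y)"
proof -
  have "(\<Prod>l<x. w (2 * int i, - 2 * int i + int l) (2 * int i, - 2 * int i + int l + 1))
      = column_weight q \<kappa> x"
  proof (cases x)
    case (Suc x')
    have "(\<Prod>l<x'. w (2 * int i, - 2 * int i + int (Suc l)) (2 * int i, - 2 * int i + int (Suc l) + 1))
        = (\<Prod>l<x'. q)"
      by (intro prod.cong refl above) simp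
    then show ?thesis
      using start Suc
      by (simp add: prod.lessThan_Suc_shift column_weight_def pt_u_def del: prod.lessThan_Suc)
  qed (simp add: column_weight_def)
  moreover have "(\<Prod>l<z - y. w (2 * int i + 2, int y - 2 * int i + int l)
      (2 * int i + 2, int y - 2 * int i + int l + 1)) = (\<Prod>l<z - y. q)"
  proof (intro prod.cong refl)
    fix l
    \<comment> \<open>In column \<open>2i + 2\<close> the path stays at height at least
      \<open>-2i\<close>, above the starting point \<open>u_(i+1)\<close>, so all its steps there
      have weight \<open>q\<close>.\<close>
    show "w (2 * int i + 2, int y - 2 * int i + int l) (2 * int i + 2, int y - 2 * int i + int l + 1) = q"
      using above[of "Suc i" "int y - 2 * int i + int l"] by (simp add: add.commute)
  qed
  moreover have "nat (int z - int y) = z - y" by simp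
  ultimately show ?thesis
    using assms(1-3) by (simp add: path_of_heights_def path_weight_three_step heights_below_def)
qed

text \<open>The hypotheses cover both weightings. The special weight is asked only at
  \<open>u_i\<close> with \<open>i < k\<close>, whereas \<open>q\<close> is asked above every
  \<open>u_j\<close>, since the last path also climbs in column \<open>2k\<close>.\<close>

lemma path_sum_eq_chain_sum:
  assumes "k \<le> m"
    and "\<And>x y. w (x, y) (x + 1, y) = 1" "\<And>x y. odd x \<Longrightarrow> w (x, y) (x, y + 1) = 1"
    and "\<And>i. i < k \<Longrightarrow> w (pt_u i) (2 * int i, - 2 * int i + 1) = \<kappa>"
    and "\<And>j y. - 2 * int j < y \<Longrightarrow> w (2 * int j, y) (2 * int j, y + 1) = q"
  shows "path_sum w m k = chain_sum q \<kappa> k (m - k) (m - k) (m - k)"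
proof -
  let ?K = "m - k"
  have "path_sum w m k = (\<Sum>ds\<in>chains k ?K ?K ?K. \<Prod>i<k. path_weight w (path_of_heights ?K i (ds ! i)))"
    unfolding path_sum_def
    by (subst sum.reindex_bij_betw[OF bij_betw_chains_path_families[OF assms(1)], symmetric]) simp
  also have "\<dots> = (\<Sum>ds\<in>chains k ?K ?K ?K. \<Prod>(x, y, z)\<leftarrow>ds. column_weight q \<kappa> x * q ^ (z - y))"
  proof (rule sum.cong)
    fix ds assume ds: "ds \<in> chains k ?K ?K ?K"
    then have len: "length ds = k" by (simp add: mem_chains_iff)
    have "path_weight w (path_of_heights ?K i (ds ! i))
        = (\<lambda>(x, y, z). column_weight q \<kappa> x * q ^ (z - y)) (ds ! i)" if "i < k" for i
    proof -
      obtain x y z where d: "ds ! i = (x, y, z)" by (cases "ds ! i")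
      have "heights_below (?K + i) (x, y, z)"
        using ds that by (simp add: mem_chains_iff flip: d)
      from path_weight_path_of_heights[OF this assms(2,3) assms(4)[OF that] assms(5)]
      show ?thesis by (simp add: d)
    qed
    then show "(\<Prod>i<k. path_weight w (path_of_heights ?K i (ds ! i)))
        = (\<Prod>(x, y, z)\<leftarrow>ds. column_weight q \<kappa> x * q ^ (z - y))"
      by (simp add: prod.list_conv_set_nth len atLeast0LessThan)
  qed simp
  also have "\<dots> = chain_sum q \<kappa> k ?K ?K ?K" by (rule sum_chains)
  finally show ?thesis .
qed

lemma path_sum_weight_P:
  assumes "k \<le> m"
  shows "path_sum weight_P m k = chain_sum [:0, 1:] [:0, 1:] k (m - k) (m - k) (m - k)"
  by (rule path_sum_eq_chain_sum[OF assms]) (auto simp: weight_P_def pt_u_def)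

lemma path_sum_weight_Q:
  assumes "k \<le> m"
  shows "path_sum (weight_Q k) m k = chain_sum [:0, 0, 1:] [:0, 1, 1:] k (m - k) (m - k) (m - k)"
proof (rule path_sum_eq_chain_sum[OF assms])
  show "weight_Q k (x, y) (x, y + 1) = 1" if "odd x" for x y
    using that by (auto simp: weight_Q_def pt_u_def)
qed (auto simp: weight_Q_def pt_u_def)

theorem theorem3p2:
  fixes m k :: nat
  shows "(k \<le> m \<longrightarrow> GZ_P m k = path_sum weight_P m k) \<and>
         (1 \<le> m \<and> k \<le> m - 1 \<longrightarrow> GZ_Q m k = path_sum (weight_Q k) m k)"
proof (intro conjI impI)
  assume "k \<le> m"
  then show "GZ_P m k = path_sum weight_P m k"
    by (simp only: GZ_P_eq path_sum_weight_P)
next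
  assume "1 \<le> m \<and> k \<le> m - 1"
  then have "1 \<le> m" "k \<le> m" by auto
  then show "GZ_Q m k = path_sum (weight_Q k) m k"
    by (simp only: GZ_Q_eq path_sum_weight_Q)
qed

end
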